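(* Let $\mathbb{F}_q$ be any finite field, and let $m:\mathbb{N}\to\mathbb{N}$ satisfy $n-m(n)\to\infty$ as $n\to\infty$. Suppose that, for all sufficiently large $n$, $m(n)\geq 2$ if $q>2$, or $m(n)\geq 3$ if $q=2$. Then $$\lim_{n\to\infty}\mathbb{P}_{A_n\sim[U_q]^{m(n)\times n}}\{M[A_n]\text{ is not a graphic matroid}\}=1.$$
   Context: $\mathbb{F}_q$ is the finite field with $q$ elements. $[U_q]^{m\times n}$ denotes the uniform distribution on $\mathbb{F}_q^{m\times n}$ (entries i.i.d. uniform on $\mathbb{F}_q$), and $A \sim [U_q]^{m \times n}$ means that $A$ is drawn from it. For a matrix $A$ over $\mathbb{F}_q$ with $n$ columns, $M[A]$ is the column dependence matroid of $A$: its ground set is the set of column indices $\{1,\dots,n\}$, and a set of indices is independent iff the corresponding columns form a linearly independent family. A matroid is graphic if it is isomorphic to the cycle matroid of a finite graph (loops and parallel edges allowed), i.e. the matroid on the edge set whose independent sets are the forests. *)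

theory Defs
  imports "HOL-Probability.Probability_Mass_Function" "Jordan_Normal_Form.VS_Connect"
begin

unbundle no vec_syntax

text \<open>
  A matroid is represented by its ground set together with the collection of its independent sets.
\<close>

type_synonym 'a matroid = "'a set \<times> 'a set set"

definition matroid_iso :: "'a matroid \<Rightarrow> 'b matroid \<Rightarrow> bool" where
  "matroid_iso M N \<longleftrightarrow>
     (\<exists>f. bij_betw f (fst M) (fst N) \<and> (\<forall>X. X \<subseteq> fst M \<longrightarrow> (X \<in> snd M \<longleftrightarrow> f ` X \<in> snd N)))"


text \<open>
  Undirected multigraphs: every edge has a set of one (for a loop) or two endpoints, and distinct
  edges may have the same endpoints.
\<close>

record ('v, 'e) multigraph =
  mg_verts :: "'v set"
  mg_edges :: "'e set"
  mg_ends :: "'e \<Rightarrow> 'v set"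

definition finite_multigraph :: "('v, 'e) multigraph \<Rightarrow> bool" where
  "finite_multigraph G \<longleftrightarrow>
     finite (mg_verts G) \<and> finite (mg_edges G) \<and>
     (\<forall>e \<in> mg_edges G. mg_ends G e \<subseteq> mg_verts G \<and> card (mg_ends G e) \<in> {1, 2})"

text \<open>
  The vertices \<open>vs\<close> are passed in cyclic order and \<open>es ! i\<close> joins \<open>vs ! i\<close> to its successor.
  A loop is a cycle of length 1, a pair of parallel edges a cycle of length 2.
\<close>

definition is_cycle :: "('v, 'e) multigraph \<Rightarrow> 'v list \<Rightarrow> 'e list \<Rightarrow> bool" where
  "is_cycle G vs es \<longleftrightarrow>
     es \<noteq> [] \<and> length vs = length es \<and> distinct vs \<and> distinct es \<and>
     set vs \<subseteq> mg_verts G \<and> set es \<subseteq> mg_edges G \<and>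
     (\<forall>i < length es. mg_ends G (es ! i) = {vs ! i, vs ! (Suc i mod length es)})"

definition forest :: "('v, 'e) multigraph \<Rightarrow> 'e set \<Rightarrow> bool" where
  "forest G F \<longleftrightarrow> F \<subseteq> mg_edges G \<and> \<not> (\<exists>vs es. is_cycle G vs es \<and> set es \<subseteq> F)"

definition cycle_matroid :: "('v, 'e) multigraph \<Rightarrow> 'e matroid" where
  "cycle_matroid G = (mg_edges G, {F. forest G F})"

text \<open>
  Every finite multigraph is isomorphic to one whose vertices and edges are natural numbers, so
  fixing these types is no restriction.
\<close>

definition graphic :: "'a matroid \<Rightarrow> bool" where
  "graphic M \<longleftrightarrow>
     (\<exists>G :: (nat, nat) multigraph. finite_multigraph G \<and> matroid_iso M (cycle_matroid G))"


text \<open>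
  \<^const>\<open>module.lin_dep\<close> is about sets of vectors; injectivity of \<^term>\<open>col A\<close> on the index set
  turns this into independence of the family of columns, so that two equal columns with
  different indices are dependent. Columns are indexed from 0.
\<close>

definition indep_columns :: "'a::field mat \<Rightarrow> nat set \<Rightarrow> bool" where
  "indep_columns A J \<longleftrightarrow>
     inj_on (col A) J \<and>
     \<not> module.lin_dep class_ring (module_vec TYPE('a) (dim_row A)) (col A ` J)"

definition column_matroid :: "'a::field mat \<Rightarrow> nat matroid" where
  "column_matroid A = ({..<dim_col A}, {J. J \<subseteq> {..<dim_col A} \<and> indep_columns A J})"

lemma indep_columns_iff:
  fixes A :: "'a::field mat"
  assumes J: "J \<subseteq> {..<dim_col A}"
  shows "indep_columns A J \<longleftrightarrow>
    (\<forall>c. (\<forall>i<dim_row A. (\<Sum>j\<in>J. c j * A $$ (i, j)) = 0) \<longrightarrow> (\<forall>j\<in>J. c j = 0))"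
    (is "_ \<longleftrightarrow> ?R")
proof -
  interpret vec_space "TYPE('a)" "dim_row A" .
  have fJ: "finite J"
    using J finite_subset by blast
  have carr: "col A ` J \<subseteq> carrier_vec (dim_row A)"
    by auto
  have lc: "lincomb a (col A ` J) = 0\<^sub>v (dim_row A) \<longleftrightarrow>
      (\<forall>i<dim_row A. (\<Sum>j\<in>J. a (col A j) * A $$ (i, j)) = 0)"
    if inj: "inj_on (col A) J" for a
  proof -
    have idx: "lincomb a (col A ` J) $ i = (\<Sum>j\<in>J. a (col A j) * A $$ (i, j))"
      if "i < dim_row A" for i
    proof -
      have "lincomb a (col A ` J) $ i = (\<Sum>x\<in>col A ` J. a x * x $ i)"
        using that carr by (rule lincomb_index)
      also have "\<dots> = (\<Sum>j\<in>J. a (col A j) * col A j $ i)"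
        using inj by (simp add: sum.reindex)
      also have "\<dots> = (\<Sum>j\<in>J. a (col A j) * A $$ (i, j))"
        using J that by (intro sum.cong) auto
      finally show ?thesis .
    qed
    have dim: "dim_vec (lincomb a (col A ` J)) = dim_row A"
      using fJ carr by (intro lincomb_dim) auto
    show ?thesis
      using idx dim by (auto simp: vec_eq_iff)
  qed
  show ?thesis
  proof
    assume L: "indep_columns A J"
    then have inj: "inj_on (col A) J" and ind: "\<not> lin_dep (col A ` J)"
      by (auto simp: indep_columns_def)
    show ?R
    proof (intro allI impI ballI, rule ccontr)
      fix c j
      assume eq: "\<forall>i<dim_row A. (\<Sum>j\<in>J. c j * A $$ (i, j)) = 0" and j: "j \<in> J" "c j \<noteq> 0"
      define a where "a = (\<lambda>v. c (the_inv_into J (col A) v))"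
      have ac: "a (col A k) = c k" if "k \<in> J" for k
        using that inj by (simp add: a_def the_inv_into_f_f)
      have "lincomb a (col A ` J) = 0\<^sub>v (dim_row A)"
        using eq by (simp add: lc[OF inj] ac)
      moreover have "a (col A j) \<noteq> 0"
        using j by (simp add: ac)
      ultimately have "lin_dep (col A ` J)"
        unfolding lin_dep_def using fJ j
        by (intro exI[of _ "col A ` J"] exI[of _ a] exI[of _ "col A j"]) auto
      then show False
        using ind by simp
    qed
  next
    assume R: ?R
    have inj: "inj_on (col A) J"
    proof (rule inj_onI, rule ccontr)
      fix j k
      assume jk: "j \<in> J" "k \<in> J" "col A j = col A k" "j \<noteq> k"
      define c :: "nat \<Rightarrow> 'a" where "c = (\<lambda>l. if l = j then 1 else if l = k then - 1 else 0)"
      have "(\<Sum>l\<in>J. c l * A $$ (i, l)) = 0" if i: "i < dim_row A" for i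
      proof -
        have "(\<Sum>l\<in>J. c l * A $$ (i, l)) = (\<Sum>l\<in>{j, k}. c l * A $$ (i, l))"
          using fJ jk by (intro sum.mono_neutral_right) (auto simp: c_def)
        also have "\<dots> = A $$ (i, j) - A $$ (i, k)"
          using jk by (simp add: c_def)
        also have "\<dots> = col A j $ i - col A k $ i"
        proof -
          have "j < dim_col A" "k < dim_col A"
            using jk J by auto
          then have "col A j $ i = A $$ (i, j)" "col A k $ i = A $$ (i, k)"
            using i by (auto intro: index_col)
          then show ?thesis
            by (simp only:)
        qed
        also have "\<dots> = 0"
          by (simp only: \<open>col A j = col A k\<close> diff_self)
        finally show ?thesis .
      qed
      then have "c j = 0"
        using R jk by blast
      then show False
        by (simp add: c_def)
    qed
    moreover have "\<not> lin_dep (col A ` J)"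
    proof
      assume "lin_dep (col A ` J)"
      then obtain a v where a: "lincomb a (col A ` J) = 0\<^sub>v (dim_row A)"
        and v: "v \<in> col A ` J" "a v \<noteq> 0"
        using finite_lin_dep[of "col A ` J"] fJ carr by auto
      from v obtain j where j: "j \<in> J" "a (col A j) \<noteq> 0"
        by blast
      have "\<forall>i<dim_row A. (\<Sum>j\<in>J. a (col A j) * A $$ (i, j)) = 0"
        by (rule iffD1[OF lc[OF inj] a])
      then have "\<forall>j\<in>J. a (col A j) = 0"
        by (rule R[THEN spec, THEN mp])
      then show False
        using j by blast
    qed
    ultimately show "indep_columns A J"
      by (simp add: indep_columns_def)
  qed
qed


definition uniform_mat :: "nat \<Rightarrow> nat \<Rightarrow> 'a::{field, finite} mat pmf" where
  "uniform_mat m n = pmf_of_set (carrier_mat m n)"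

text \<open>\<^const>\<open>pmf_of_set\<close> is only meaningful for finite nonempty sets.\<close>

lemma finite_carrier_mat: "finite (carrier_mat m n :: 'a::finite mat set)"
proof -
  let ?F = "({..<m} \<times> {..<n}) \<rightarrow>\<^sub>E (UNIV :: 'a set)"
  have "A \<in> mat m n ` ?F" if "A \<in> carrier_mat m n" for A :: "'a mat"
  proof -
    define f where "f = restrict (\<lambda>p. A $$ p) ({..<m} \<times> {..<n})"
    have "f \<in> ?F"
      unfolding f_def by (rule restrict_PiE[THEN iffD2]) simp
    moreover have "A = mat m n f"
      using that by (intro eq_matI) (auto simp: f_def)
    ultimately show ?thesis
      by blast
  qed
  then have "carrier_mat m n \<subseteq> mat m n ` ?F"
    by blast
  moreover have "finite ?F"
    by (intro finite_PiE) simp_all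
  ultimately show ?thesis
    by (meson finite_imageI finite_subset)
qed

lemma carrier_mat_nonempty: "(carrier_mat m n :: 'a mat set) \<noteq> {}"
proof -
  have "mat m n f \<in> carrier_mat m n" for f :: "nat \<times> nat \<Rightarrow> 'a"
    by simp
  then show ?thesis
    by blast
qed

end

theory Submission
  imports Defs "HOL-Library.Function_Algebras" "HOL-Library.Z2"
begin

text \<open>
  Let \<open>d = 2\<close> if \<open>q > 2\<close> and \<open>d = 3\<close> if \<open>q = 2\<close>, and let \<open>k = m + (n - m) div 2\<close>. With high
  probability the first \<open>k\<close> columns span the whole space. Choose a basis among them and contract
  all but \<open>d\<close> of its elements: the remaining \<open>d\<close> coordinates of the last \<open>n - k\<close> columns are
  independent and uniform, so with high probability every vector of length \<open>d\<close> occurs among them.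
  This gives a \<open>U\<^sub>2\<^sub>,\<^sub>4\<close> minor if \<open>q > 2\<close> and a Fano minor if \<open>q = 2\<close>. A graphic matroid is
  represented over every field by the signed incidence vectors of its edges, whereas the
  first of these minors is not representable over the two-element field, and the second
  is not representable over the reals.
\<close>

section \<open>Graphic matroids are representable over every field\<close>

text \<open>The value of d reflects the number of points on a projective line over F_q, namely q +
  1. If q > 2 there are at least four, so a plane already contains a non-binary configuration. If q
  = 2 there are three, every rank 2 matroid of columns is graphic (a triangle with parallel edges
  and loops), and the obstruction has to come from rank 3.

  No contracted matroid is ever formed. The contracted set C is independent, so T is independent
  after contraction exactly when C \<union> T is independent. C is therefore carried along in every
  set, and representability never has to be passed on to minors.

  The coordinates that survive contraction are determined by the first k columns, so they are fixed
  before the remaining columns are chosen. Spanning fails with probability at most q^(m-k), and some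
  vector of length d is missed with probability at most q^d (1 - q^(-d))^(n-k). A larger k helps the
  first bound and hurts the second; sharing the surplus n - m equally makes both vanish, whatever
  the growth of m.\<close>

definition family_indep :: "('i \<Rightarrow> 'v \<Rightarrow> 'k::field) \<Rightarrow> 'i set \<Rightarrow> bool" where
  "family_indep w J \<longleftrightarrow> (\<forall>c. (\<forall>v. (\<Sum>j\<in>J. c j * w j v) = 0) \<longrightarrow> (\<forall>j\<in>J. c j = 0))"

lemma family_indep_image:
  assumes "inj_on f J"
  shows "family_indep w (f ` J) \<longleftrightarrow> family_indep (w \<circ> f) J"
proof
  assume L: "family_indep w (f ` J)"
  show "family_indep (w \<circ> f) J"
    unfolding family_indep_def
  proof (intro allI impI ballI)
    fix c j
    assume c: "\<forall>v. (\<Sum>j\<in>J. c j * (w \<circ> f) j v) = 0" and j: "j \<in> J"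
    have "(\<Sum>e\<in>f ` J. c (the_inv_into J f e) * w e v) = 0" for v
      using c assms by (simp add: sum.reindex the_inv_into_f_f)
    then have "\<forall>e\<in>f ` J. c (the_inv_into J f e) = 0"
      using L[unfolded family_indep_def, rule_format, of "c \<circ> the_inv_into J f"] by simp
    then show "c j = 0"
      using j assms by (simp add: the_inv_into_f_f)
  qed
next
  assume R: "family_indep (w \<circ> f) J"
  show "family_indep w (f ` J)"
    unfolding family_indep_def
  proof (intro allI impI ballI)
    fix c e
    assume c: "\<forall>v. (\<Sum>e\<in>f ` J. c e * w e v) = 0" and e: "e \<in> f ` J"
    have "(\<Sum>j\<in>J. (c \<circ> f) j * (w \<circ> f) j v) = 0" for v
      using c[rule_format, of v] assms by (simp add: sum.reindex)
    then have "\<forall>j\<in>J. (c \<circ> f) j = 0"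
      using R[unfolded family_indep_def] by blast
    then show "c e = 0"
      using e by auto
  qed
qed

text \<open>The linear order on the vertices supplies the orientation: an edge points from its
  smaller to its larger endpoint. A loop gets the zero vector.\<close>

definition incidence :: "('v::linorder, 'e) multigraph \<Rightarrow> 'e \<Rightarrow> 'v \<Rightarrow> 'k::field" where
  "incidence G e v = of_bool (v = Max (mg_ends G e)) - of_bool (v = Min (mg_ends G e))"

text \<open>A cycle traverses its edges in directions unrelated to the order of the vertices; a sign
  turns the fixed orientation into the direction of travel.\<close>

lemma incidence_orient:
  assumes "mg_ends G e = {u, v}"
  obtains s where "s \<noteq> (0::'k::field)" "\<And>x. s * incidence G e x = of_bool (x = v) - of_bool (x = u)"
proof (cases "u \<le> v")
  case True
  then show ?thesis
    using assms by (intro that[of 1]) (auto simp: incidence_def max_def min_def)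
next
  case False
  then show ?thesis
    using assms by (intro that[of "-1"]) (auto simp: incidence_def max_def min_def)
qed

lemma incidence_nonzero_iff:
  assumes "card (mg_ends G e) = 2"
  shows "incidence G e v \<noteq> (0::'k::field) \<longleftrightarrow> v \<in> mg_ends G e"
proof -
  obtain x y where "mg_ends G e = {x, y}" "x \<noteq> y"
    using assms by (auto simp: card_2_iff)
  then show ?thesis
    by (auto simp: incidence_def max_def min_def)
qed

text \<open>A longest path cannot be prolonged at its first vertex, so a second edge at that vertex
  leads back into the path and closes a cycle.\<close>

lemma exists_cycle:
  assumes fin: "finite (mg_verts G)"
    and F: "F \<subseteq> mg_edges G" "F \<noteq> {}"
    and ends: "\<And>e. e \<in> F \<Longrightarrow> mg_ends G e \<subseteq> mg_verts G \<and> card (mg_ends G e) = 2"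
    and deg: "\<And>e v. e \<in> F \<Longrightarrow> v \<in> mg_ends G e \<Longrightarrow> \<exists>e'\<in>F. e' \<noteq> e \<and> v \<in> mg_ends G e'"
  shows "\<exists>vs es. is_cycle G vs es \<and> set es \<subseteq> F"
proof -
  define P where "P = (\<lambda>vs es. es \<noteq> [] \<and> length vs = Suc (length es) \<and> distinct vs \<and>
    set vs \<subseteq> mg_verts G \<and> set es \<subseteq> F \<and>
    (\<forall>i < length es. mg_ends G (es ! i) = {vs ! i, vs ! Suc i}))"
  have bound: "length es \<le> card (mg_verts G)" if "P vs es" for vs es
  proof -
    have "length vs = card (set vs)"
      using that by (simp add: P_def distinct_card)
    also have "\<dots> \<le> card (mg_verts G)"
      using that fin by (intro card_mono) (auto simp: P_def)
    finally show ?thesis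
      using that by (simp add: P_def)
  qed
  obtain e where e: "e \<in> F"
    using F by blast
  then obtain u v where uv: "mg_ends G e = {u, v}" "u \<noteq> v"
    using ends by (meson card_2_iff)
  have "u \<in> mg_verts G" "v \<in> mg_verts G"
    using ends[OF e] uv(1) by simp_all
  then have "P [u, v] [e]"
    unfolding P_def using e uv(2) by (intro conjI) (simp_all add: uv(1))
  then have Puv: "case_prod P ([u, v], [e])"
    by simp
  have "\<forall>p. case_prod P p \<longrightarrow> length (snd p) < Suc (card (mg_verts G))"
    using bound by (simp add: split_def less_Suc_eq_le)
  from ex_has_greatest_nat[OF Puv this] obtain p
    where p: "case_prod P p" "\<And>q. case_prod P q \<Longrightarrow> length (snd q) \<le> length (snd p)"
    by (elim exE conjE) blast
  obtain vs es where vs_es: "p = (vs, es)"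
    by (rule prod.exhaust)
  have P: "P vs es"
    using p(1) by (simp add: vs_es)
  have max: "length es' \<le> length es" if "P vs' es'" for vs' es'
    using p(2)[of "(vs', es')"] that by (simp add: vs_es)
  have len: "es \<noteq> []" "length vs = Suc (length es)" and dist: "distinct vs"
    and path: "\<And>i. i < length es \<Longrightarrow> mg_ends G (es ! i) = {vs ! i, vs ! Suc i}"
    and esF: "set es \<subseteq> F" and vsV: "set vs \<subseteq> mg_verts G"
    using P by (auto simp: P_def)
  have "es ! 0 \<in> F" "vs ! 0 \<in> mg_ends G (es ! 0)"
    using len esF path[of 0] by auto
  from deg[OF this] obtain e' where e': "e' \<in> F" "e' \<noteq> es ! 0" "vs ! 0 \<in> mg_ends G e'"
    by blast
  have "\<exists>u. mg_ends G e' = {vs ! 0, u} \<and> u \<noteq> vs ! 0"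
  proof -
    obtain x y where "mg_ends G e' = {x, y}" "x \<noteq> y"
      using ends[OF e'(1)] by (meson card_2_iff)
    then show ?thesis
      using e'(3) by auto
  qed
  then obtain u where u: "mg_ends G e' = {vs ! 0, u}" "u \<noteq> vs ! 0"
    by blast
  \<comment> \<open>Otherwise prepending \<open>u\<close> and \<open>e'\<close> would give a longer
    path.\<close>
  have "u \<in> set vs"
  proof (rule ccontr)
    assume "u \<notin> set vs"
    moreover have "u \<in> mg_verts G"
      using ends[OF e'(1)] u(1) by simp
    moreover have "mg_ends G ((e' # es) ! i) = {(u # vs) ! i, (u # vs) ! Suc i}"
      if "i < length (e' # es)" for i
      using that u(1) path[of "i - 1"] by (cases i) auto
    ultimately have "P (u # vs) (e' # es)"
      using P e'(1) by (simp add: P_def)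
    from max[OF this] show False
      by simp
  qed
  then obtain j where j: "j < length vs" "u = vs ! j"
    by (metis in_set_conv_nth)
  have j0: "0 < j" "j \<le> length es"
    using j u len by (auto intro: gr0I)
  have inj: "es ! a \<noteq> es ! b" if "a < b" "b < length es" for a b
  proof
    assume "es ! a = es ! b"
    then have "{vs ! a, vs ! Suc a} = {vs ! b, vs ! Suc b}"
      using path[of a] path[of b] that by simp
    then have "vs ! a = vs ! b \<or> vs ! a = vs ! Suc b"
      by blast
    then show False
      using that dist len by (simp add: nth_eq_iff_index_eq)
  qed
  \<comment> \<open>The only path edge at the first vertex is \<open>es ! 0\<close>, which
    \<open>e'\<close> was chosen to avoid.\<close>
  have e'es: "e' \<noteq> es ! i" if "i < length es" for i
  proof (cases "i = 0")
    case False
    then have "vs ! 0 \<notin> mg_ends G (es ! i)"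
      using that path[OF that] dist len by (simp add: nth_eq_iff_index_eq)
    then show ?thesis
      using e' by blast
  qed (use e' in simp)
  have "distinct es"
    unfolding distinct_conv_nth using inj by (metis linorder_neqE_nat)
  moreover have "e' \<notin> set (take j es)"
    using e'es by (metis in_set_conv_nth in_set_takeD)
  ultimately have d: "distinct (take j es @ [e'])"
    by simp
  \<comment> \<open>Follow the path from \<open>vs ! 0\<close> to \<open>vs ! j\<close> and return
    along \<open>e'\<close>. For \<open>j = 1\<close> this is a pair of parallel edges.\<close>
  have "is_cycle G (take (Suc j) vs) (take j es @ [e'])"
    unfolding is_cycle_def
  proof (intro conjI allI impI)
    show "set (take (Suc j) vs) \<subseteq> mg_verts G" "set (take j es @ [e']) \<subseteq> mg_edges G"
      using vsV esF e' F set_take_subset[of "Suc j" vs] set_take_subset[of j es] by auto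
    fix i
    assume "i < length (take j es @ [e'])"
    then have "i \<le> j"
      using j0 by simp
    then show "mg_ends G ((take j es @ [e']) ! i) =
        {take (Suc j) vs ! i, take (Suc j) vs ! (Suc i mod length (take j es @ [e']))}"
      using j0 j u path[of i] by (cases "i = j") (auto simp: nth_append)
  qed (use d dist len j0 in auto)
  moreover have "set (take j es @ [e']) \<subseteq> F"
    using e'(1) esF set_take_subset[of j es] by auto
  ultimately show ?thesis
    by blast
qed

text \<open>Going round the cycle, every vertex is entered once and left once, so the incidence
  vectors, signed by the direction of travel, add up to zero. For a loop the single vector is itself
  zero.\<close>

lemma cycle_dependent:
  fixes G :: "('v::linorder, 'e) multigraph"
  assumes cyc: "is_cycle G vs es" and F: "set es \<subseteq> F" "finite F"
  shows "\<not> family_indep (incidence G :: 'e \<Rightarrow> 'v \<Rightarrow> 'k::field) F"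
proof -
  let ?l = "length es"
  have l: "0 < ?l" "length vs = ?l" and dist: "distinct vs" "distinct es"
    and ends: "\<And>i. i < ?l \<Longrightarrow> mg_ends G (es ! i) = {vs ! i, vs ! (Suc i mod ?l)}"
    using cyc by (auto simp: is_cycle_def)
  have "\<exists>s::'k. s \<noteq> 0 \<and> (\<forall>x. s * incidence G (es ! i) x =
      of_bool (x = vs ! (Suc i mod ?l)) - of_bool (x = vs ! i))" if "i < ?l" for i
    using incidence_orient[OF ends[OF that]] by metis
  then obtain s :: "nat \<Rightarrow> 'k" where s: "\<And>i. i < ?l \<Longrightarrow> s i \<noteq> 0"
    "\<And>i x. i < ?l \<Longrightarrow> s i * incidence G (es ! i) x =
      of_bool (x = vs ! (Suc i mod ?l)) - of_bool (x = vs ! i)"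
    by metis
  have bij: "bij_betw ((!) es) {..<?l} (set es)"
    using dist by (intro bij_betw_nth) auto
  define c where "c = (\<lambda>e. if e \<in> set es then s (the_inv_into {..<?l} ((!) es) e) else 0)"
  have c: "c (es ! i) = s i" if "i < ?l" for i
    using that bij by (simp add: c_def bij_betw_def the_inv_into_f_f)
  \<comment> \<open>Heads are a cyclic shift of tails, which lets the two sums cancel.\<close>
  have rot: "bij_betw (\<lambda>i. Suc i mod ?l) {..<?l} {..<?l}"
  proof -
    have "Suc i mod ?l = Suc j mod ?l \<Longrightarrow> i = j" if "i < ?l" "j < ?l" for i j
      using that by (metis Suc_lessI mod_less mod_self nat.distinct(1) nat.inject)
    then have "inj_on (\<lambda>i. Suc i mod ?l) {..<?l}"
      by (auto simp: inj_on_def)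
    then show ?thesis
      using l by (simp add: bij_betw_def endo_inj_surj image_subset_iff)
  qed
  have "(\<Sum>e\<in>F. c e * incidence G e x) = 0" for x
  proof -
    have "(\<Sum>e\<in>F. c e * incidence G e x) = (\<Sum>e\<in>set es. c e * incidence G e x)"
      using F by (intro sum.mono_neutral_right) (auto simp: c_def)
    also have "\<dots> = (\<Sum>i<?l. c (es ! i) * incidence G (es ! i) x)"
      using bij by (rule sum.reindex_bij_betw[symmetric])
    also have "\<dots> = (\<Sum>i<?l. of_bool (x = vs ! (Suc i mod ?l)) - of_bool (x = vs ! i))"
      by (intro sum.cong) (simp_all add: c s)
    also have "\<dots> = 0"
      using sum.reindex_bij_betw[OF rot, of "\<lambda>i. of_bool (x = vs ! i) :: 'k"]
      by (simp add: sum_subtractf)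
    finally show ?thesis .
  qed
  moreover have "es ! 0 \<in> F" "c (es ! 0) \<noteq> 0"
    using F l s c by auto
  ultimately show ?thesis
    unfolding family_indep_def by blast
qed

text \<open>The support of a nontrivial relation has no leaves: at a vertex met by only one edge of
  the support, the coordinate of the relation would be a single nonzero term. Such a support
  contains a cycle.\<close>

lemma forest_iff_family_indep:
  fixes G :: "('v::linorder, 'e) multigraph"
  assumes G: "finite_multigraph G" and F: "F \<subseteq> mg_edges G"
  shows "forest G F \<longleftrightarrow> family_indep (incidence G :: 'e \<Rightarrow> 'v \<Rightarrow> 'k::field) F"
proof
  have finF: "finite F"
    using G F by (auto simp: finite_multigraph_def intro: finite_subset)
  {
    assume "family_indep (incidence G :: 'e \<Rightarrow> 'v \<Rightarrow> 'k::field) F"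
    then show "forest G F"
      unfolding forest_def using cycle_dependent finF F by blast
  }
  assume forest: "forest G F"
  show "family_indep (incidence G :: 'e \<Rightarrow> 'v \<Rightarrow> 'k) F"
  proof (rule ccontr)
    assume "\<not> ?thesis"
    then obtain c :: "'e \<Rightarrow> 'k" and e0 where c: "\<And>v. (\<Sum>e\<in>F. c e * incidence G e v) = 0"
      and e0: "e0 \<in> F" "c e0 \<noteq> 0"
      unfolding family_indep_def by blast
    define F' where "F' = {e \<in> F. c e \<noteq> 0}"
    \<comment> \<open>A loop would be a cycle of length 1 inside the forest.\<close>
    have card2: "card (mg_ends G e) = 2" if "e \<in> F" for e
    proof (rule ccontr)
      assume "card (mg_ends G e) \<noteq> 2"
      moreover have *: "mg_ends G e \<subseteq> mg_verts G" "card (mg_ends G e) \<in> {1, 2}"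
        using G F that by (auto simp: finite_multigraph_def)
      ultimately obtain v where "mg_ends G e = {v}"
        by (auto simp: card_1_singleton_iff)
      moreover from this have "v \<in> mg_verts G"
        using * by simp
      ultimately have "is_cycle G [v] [e]"
        using F that by (auto simp: is_cycle_def)
      moreover have "set [e] \<subseteq> F"
        using that by simp
      ultimately show False
        using forest unfolding forest_def by blast
    qed
    have "\<exists>vs es. is_cycle G vs es \<and> set es \<subseteq> F'"
    proof (rule exists_cycle)
      show "finite (mg_verts G)" "F' \<subseteq> mg_edges G" "F' \<noteq> {}"
        using G F e0 by (auto simp: finite_multigraph_def F'_def)
      show "mg_ends G e \<subseteq> mg_verts G \<and> card (mg_ends G e) = 2" if "e \<in> F'" for e
        using that G F card2 by (auto simp: finite_multigraph_def F'_def)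
      fix e v
      assume e: "e \<in> F'" "v \<in> mg_ends G e"
      show "\<exists>e'\<in>F'. e' \<noteq> e \<and> v \<in> mg_ends G e'"
      proof (rule ccontr)
        assume "\<not> ?thesis"
        then have "c e' * incidence G e' v = 0" if "e' \<in> F - {e}" for e'
          using that card2 incidence_nonzero_iff[of G e' v, where ?'k = 'k] by (auto simp: F'_def)
        then have "(\<Sum>e'\<in>F - {e}. c e' * incidence G e' v) = 0"
          by (intro sum.neutral) blast
        then have "(\<Sum>e\<in>F. c e * incidence G e v) = c e * incidence G e v"
          using finF e by (subst sum.remove[of _ e]) (auto simp: F'_def)
        moreover have "c e * incidence G e v \<noteq> 0"
          using e card2 incidence_nonzero_iff[of G e v, where ?'k = 'k] by (auto simp: F'_def)
        ultimately show False
          using c by simp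
      qed
    qed
    then show False
      using forest by (auto simp: forest_def F'_def)
  qed
qed

text \<open>The field \<open>'k\<close> is unrelated to the field of the entries of
  \<open>A\<close>, because the same graph has incidence vectors over any field. It is later taken
  to be \<open>bit\<close> or \<open>real\<close>, whichever excludes the minor at hand.\<close>

lemma graphic_represented:
  fixes A :: "'a::field mat"
  assumes "graphic (column_matroid A)"
  obtains w :: "nat \<Rightarrow> nat \<Rightarrow> 'k::field"
  where "\<And>J. J \<subseteq> {..<dim_col A} \<Longrightarrow> indep_columns A J \<longleftrightarrow> family_indep w J"
proof -
  obtain G :: "(nat, nat) multigraph" and f where G: "finite_multigraph G"
    and f: "bij_betw f {..<dim_col A} (mg_edges G)"
    and iff: "\<And>J. J \<subseteq> {..<dim_col A} \<Longrightarrow> indep_columns A J \<longleftrightarrow> forest G (f ` J)"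
    using assms unfolding graphic_def matroid_iso_def column_matroid_def cycle_matroid_def by auto
  have "indep_columns A J \<longleftrightarrow> family_indep (incidence G \<circ> f :: nat \<Rightarrow> nat \<Rightarrow> 'k) J"
    if J: "J \<subseteq> {..<dim_col A}" for J
  proof -
    have "f ` J \<subseteq> mg_edges G" "inj_on f J"
      using f J by (auto simp: bij_betw_def intro: inj_on_subset)
    then show ?thesis
      using iff[OF J] forest_iff_family_indep[OF G] family_indep_image by metis
  qed
  then show thesis
    by (rule that)
qed

section \<open>Excluded minors\<close>

text \<open>Coefficients are total functions vanishing off \<open>J\<close>, so relations with
  different supports can be added pointwise and summed over any common finite superset. The witness
  \<open>U\<close> also forces \<open>J\<close> to be finite, which rules out relations that hold
  only because infinite sums default to zero.\<close>

definition relation_on :: "('i \<Rightarrow> 'v \<Rightarrow> 'k::field) \<Rightarrow> 'i set \<Rightarrow> ('i \<Rightarrow> 'k) \<Rightarrow> bool" where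
  "relation_on w J c \<longleftrightarrow>
     (\<exists>U. finite U \<and> J \<subseteq> U \<and> (\<forall>v. (\<Sum>j\<in>U. c j * w j v) = 0)) \<and> (\<forall>j. j \<notin> J \<longrightarrow> c j = 0)"

lemma relation_on_sum:
  assumes "relation_on w J c" "J \<subseteq> U" "finite U"
  shows "(\<Sum>j\<in>U. c j * w j v) = 0"
proof -
  from assms obtain U' where U': "finite U'" "J \<subseteq> U'" "(\<Sum>j\<in>U'. c j * w j v) = 0"
    by (auto simp: relation_on_def)
  have "(\<Sum>j\<in>U. c j * w j v) = (\<Sum>j\<in>J. c j * w j v)"
    using assms by (intro sum.mono_neutral_right) (auto simp: relation_on_def)
  also have "\<dots> = (\<Sum>j\<in>U'. c j * w j v)"
    using assms U' by (intro sum.mono_neutral_left) (auto simp: relation_on_def)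
  finally show ?thesis
    using U' by simp
qed

lemma relation_on_finite: "relation_on w J c \<Longrightarrow> finite J"
  by (auto simp: relation_on_def intro: finite_subset)

lemma relation_on_subset:
  assumes "relation_on w J c" "\<And>j. j \<in> J - J' \<Longrightarrow> c j = 0" "finite J'"
  shows "relation_on w J' c"
  unfolding relation_on_def
proof (intro conjI exI allI impI)
  show "(\<Sum>j\<in>J \<union> J'. c j * w j v) = 0" for v
    using assms relation_on_finite by (intro relation_on_sum[OF assms(1)]) auto
  show "c j = 0" if "j \<notin> J'" for j
    using that assms by (auto simp: relation_on_def)
qed (use assms relation_on_finite in auto)

lemma relation_on_combine:
  assumes "relation_on w J c" "relation_on w J' d"
  shows "relation_on w (J \<union> J') (\<lambda>j. a * c j + b * d j)"
  unfolding relation_on_def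
proof (intro conjI exI allI impI)
  have fin: "finite (J \<union> J')"
    using assms relation_on_finite by blast
  then show "finite (J \<union> J')" .
  show "(\<Sum>j\<in>J \<union> J'. (a * c j + b * d j) * w j v) = 0" for v
  proof -
    have "(\<Sum>j\<in>J \<union> J'. (a * c j + b * d j) * w j v) =
        a * (\<Sum>j\<in>J \<union> J'. c j * w j v) + b * (\<Sum>j\<in>J \<union> J'. d j * w j v)"
      by (simp add: algebra_simps sum.distrib sum_distrib_left)
    then show ?thesis
      using assms fin by (simp add: relation_on_sum)
  qed
qed (use assms in \<open>auto simp: relation_on_def\<close>)

text \<open>The elimination principle of this section: once the coefficients outside an independent
  set have been cancelled, those inside it vanish too.\<close>

lemma relation_on_indep:
  assumes "relation_on w J c" "family_indep w J'" "\<And>j. j \<in> J - J' \<Longrightarrow> c j = 0" "finite J'"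
  shows "c j = 0"
proof -
  have R: "relation_on w J' c"
    by (rule relation_on_subset[OF assms(1,3,4)])
  have "\<forall>v. (\<Sum>j\<in>J'. c j * w j v) = 0"
    using relation_on_sum[OF R] assms(4) by blast
  then have "\<forall>j\<in>J'. c j = 0"
    using assms(2) unfolding family_indep_def by blast
  then show ?thesis
    using R by (auto simp: relation_on_def)
qed

text \<open>Modulo \<open>C\<close> the three points are collinear and pairwise independent. The
  coefficients on \<open>C\<close> are left unspecified, since later arguments compare only those at
  the points.\<close>

lemma relation_on_line:
  assumes C: "finite C" and "a \<notin> C" "b \<notin> C" "x \<notin> C"
    and dep: "\<not> family_indep w (C \<union> {a, b, x})"
    and ind: "family_indep w (C \<union> {a, b})" "family_indep w (C \<union> {a, x})" "family_indep w (C \<union> {b, x})"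
  obtains c where "relation_on w (C \<union> {a, b, x}) c" "c a \<noteq> 0" "c b \<noteq> 0" "c x = 1"
proof -
  let ?J = "C \<union> {a, b, x}"
  from dep obtain c j where c: "\<And>v. (\<Sum>j\<in>?J. c j * w j v) = 0" and j: "j \<in> ?J" "c j \<noteq> 0"
    unfolding family_indep_def by blast
  define d where "d = (\<lambda>j. if j \<in> ?J then c j else 0)"
  have "(\<Sum>j\<in>?J. d j * w j v) = 0" for v
  proof -
    have "(\<Sum>j\<in>?J. d j * w j v) = (\<Sum>j\<in>?J. c j * w j v)"
      by (intro sum.cong) (auto simp: d_def)
    then show ?thesis
      using c by simp
  qed
  then have d: "relation_on w ?J d"
    unfolding relation_on_def using C by (intro conjI exI[of _ ?J]) (auto simp: d_def)
  have dj: "d j \<noteq> 0"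
    using j by (simp add: d_def)
  \<comment> \<open>If one of these were zero, the relation would live on the independent set formed
    by \<open>C\<close> and the other two points.\<close>
  have nz: "d a \<noteq> 0" "d b \<noteq> 0" "d x \<noteq> 0"
    using relation_on_indep[OF d ind(1), of j] relation_on_indep[OF d ind(2), of j]
      relation_on_indep[OF d ind(3), of j] dj C by auto
  have "relation_on w (?J \<union> ?J) (\<lambda>j. inverse (d x) * d j + 0 * d j)"
    by (rule relation_on_combine[OF d d])
  then have "relation_on w ?J (\<lambda>j. inverse (d x) * d j)"
    by simp
  then show thesis
    using nz by (intro that[of "\<lambda>j. inverse (d x) * d j"]) auto
qed

text \<open>Modulo the span of \<open>C\<close>, a plane over the two-element field has only three nonzero vectors.\<close>

lemma no_binary_U24:
  fixes w :: "'i \<Rightarrow> 'v \<Rightarrow> bit"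
  assumes C: "finite C" "C \<inter> {p, q, r, s} = {}" and dist: "distinct [p, q, r, s]"
    and ind: "\<And>x y. x \<in> {p, q, r, s} \<Longrightarrow> y \<in> {p, q, r, s} \<Longrightarrow> x \<noteq> y \<Longrightarrow> family_indep w (C \<union> {x, y})"
    and dep: "\<not> family_indep w (C \<union> {p, q, r})" "\<not> family_indep w (C \<union> {p, q, s})"
  shows False
proof -
  obtain c where c: "relation_on w (C \<union> {p, q, r}) c" "c p \<noteq> 0" "c q \<noteq> 0" "c r = 1"
    by (rule relation_on_line[OF C(1) _ _ _ dep(1)]) (use C dist ind in auto)
  obtain d where d: "relation_on w (C \<union> {p, q, s}) d" "d p \<noteq> 0" "d q \<noteq> 0" "d s = 1"
    by (rule relation_on_line[OF C(1) _ _ _ dep(2)]) (use C dist ind in auto)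
  have "d r = 0"
    using d(1) C dist by (auto simp: relation_on_def)
  \<comment> \<open>Nonzero elements of \<open>bit\<close> are equal to 1, so \<open>c\<close> and
    \<open>d\<close> cancel at \<open>p\<close> and \<open>q\<close>. What remains lives on the
    independent set formed by \<open>C\<close>, \<open>r\<close> and \<open>s\<close>, although its
    coefficient at \<open>r\<close> is 1.\<close>
  have one: "1 * c r + 1 * d r = 0"
  proof (rule relation_on_indep[OF relation_on_combine[OF c(1) d(1)], of "C \<union> {r, s}" 1 1])
    show "family_indep w (C \<union> {r, s})"
      using ind dist by auto
    show "1 * c j + 1 * d j = 0" if "j \<in> C \<union> {p, q, r} \<union> (C \<union> {p, q, s}) - (C \<union> {r, s})" for j
      using that c d by auto
  qed (use C in auto)
  then show False
    using c \<open>d r = 0\<close> by simp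
qed

text \<open>
  Modulo \<open>C\<close> the points \<open>x\<close>, \<open>y\<close>, \<open>z\<close> lie on the sides of the triangle \<open>p q r\<close>, and lie on the lines
  joining \<open>t\<close> to the opposite corners. Eliminating everything but \<open>p\<close>, \<open>q\<close>, \<open>r\<close> from
  the relation on the line \<open>x y z\<close> leaves a factor 2.
\<close>

lemma no_fano:
  fixes w :: "'i \<Rightarrow> 'v \<Rightarrow> 'k::field"
  assumes two: "(2::'k) \<noteq> 0"
    and C: "finite C" "C \<inter> {p, q, r, x, y, z, t} = {}" and dist: "distinct [p, q, r, x, y, z, t]"
    and ind: "\<And>u v. u \<in> {p, q, r, x, y, z, t} \<Longrightarrow> v \<in> {p, q, r, x, y, z, t} \<Longrightarrow> u \<noteq> v \<Longrightarrow>
      family_indep w (C \<union> {u, v})"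
    and ind3: "family_indep w (C \<union> {p, q, r})"
    and dep: "\<not> family_indep w (C \<union> {p, q, x})" "\<not> family_indep w (C \<union> {p, r, y})"
      "\<not> family_indep w (C \<union> {q, r, z})" "\<not> family_indep w (C \<union> {r, x, t})"
      "\<not> family_indep w (C \<union> {q, y, t})" "\<not> family_indep w (C \<union> {p, z, t})"
      "\<not> family_indep w (C \<union> {x, y, z})"
  shows False
proof -
  note line = relation_on_line[OF C(1) _ _ _ dep(1)] relation_on_line[OF C(1) _ _ _ dep(2)]
    relation_on_line[OF C(1) _ _ _ dep(3)] relation_on_line[OF C(1) _ _ _ dep(4)]
    relation_on_line[OF C(1) _ _ _ dep(5)] relation_on_line[OF C(1) _ _ _ dep(6)]
    relation_on_line[OF C(1) _ _ _ dep(7)]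
  obtain f1 where f1: "relation_on w (C \<union> {p, q, x}) f1" "f1 p \<noteq> 0" "f1 q \<noteq> 0" "f1 x = 1"
    by (rule line(1)) (use C dist ind in auto)
  obtain f2 where f2: "relation_on w (C \<union> {p, r, y}) f2" "f2 p \<noteq> 0" "f2 r \<noteq> 0" "f2 y = 1"
    by (rule line(2)) (use C dist ind in auto)
  obtain f3 where f3: "relation_on w (C \<union> {q, r, z}) f3" "f3 q \<noteq> 0" "f3 r \<noteq> 0" "f3 z = 1"
    by (rule line(3)) (use C dist ind in auto)
  obtain f4 where f4: "relation_on w (C \<union> {r, x, t}) f4" "f4 r \<noteq> 0" "f4 x \<noteq> 0" "f4 t = 1"
    by (rule line(4)) (use C dist ind in auto)
  obtain f5 where f5: "relation_on w (C \<union> {q, y, t}) f5" "f5 q \<noteq> 0" "f5 y \<noteq> 0" "f5 t = 1"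
    by (rule line(5)) (use C dist ind in auto)
  obtain f6 where f6: "relation_on w (C \<union> {p, z, t}) f6" "f6 p \<noteq> 0" "f6 z \<noteq> 0" "f6 t = 1"
    by (rule line(6)) (use C dist ind in auto)
  obtain f7 where f7: "relation_on w (C \<union> {x, y, z}) f7" "f7 x \<noteq> 0" "f7 y \<noteq> 0" "f7 z = 1"
    by (rule line(7)) (use C dist ind in auto)
  \<comment> \<open>A combination from which all of \<open>x\<close>, \<open>y\<close>,
    \<open>z\<close>, \<open>t\<close> have been eliminated is trivial, so its coefficients at
    \<open>p\<close>, \<open>q\<close>, \<open>r\<close> give equations.\<close>
  have zero: "f j = 0" if "relation_on w (C \<union> S) f" "\<And>j. j \<in> S - {p, q, r} \<Longrightarrow> f j = 0" for f j S
    by (rule relation_on_indep[OF that(1) ind3]) (use that C in auto)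
  have off: "f j = 0" if "relation_on w (C \<union> S) f" "j \<notin> C" "j \<notin> S" for f j S
    using that by (auto simp: relation_on_def)
  note comb = relation_on_combine
  have un: "C \<union> S \<union> (C \<union> S') = C \<union> (S \<union> S')" for S S'
    by blast
  have nC: "p \<notin> C" "q \<notin> C" "r \<notin> C" "x \<notin> C" "y \<notin> C" "z \<notin> C" "t \<notin> C"
    using C by auto
  have v1 [simp]: "f1 r = 0" "f1 y = 0" "f1 z = 0" "f1 t = 0"
    using off[OF f1(1)] nC dist by auto
  have v2 [simp]: "f2 q = 0" "f2 x = 0" "f2 z = 0" "f2 t = 0"
    using off[OF f2(1)] nC dist by auto
  have v3 [simp]: "f3 p = 0" "f3 x = 0" "f3 y = 0" "f3 t = 0"
    using off[OF f3(1)] nC dist by auto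
  have v4 [simp]: "f4 p = 0" "f4 q = 0" "f4 y = 0" "f4 z = 0"
    using off[OF f4(1)] nC dist by auto
  have v5 [simp]: "f5 p = 0" "f5 r = 0" "f5 x = 0" "f5 z = 0"
    using off[OF f5(1)] nC dist by auto
  have v6 [simp]: "f6 q = 0" "f6 r = 0" "f6 x = 0" "f6 y = 0"
    using off[OF f6(1)] nC dist by auto
  have v7 [simp]: "f7 p = 0" "f7 q = 0" "f7 r = 0" "f7 t = 0"
    using off[OF f7(1)] nC dist by auto
  note [simp] = f1(4) f2(4) f3(4) f4(4) f5(4) f6(4) f7(4)
  \<comment> \<open>\<open>f4\<close>, \<open>f5\<close> and \<open>f6\<close> each express
    \<open>t\<close> through a corner and the point on the opposite side; \<open>f1\<close>,
    \<open>f2\<close> and \<open>f3\<close> then replace that point by corners. \<open>A\<close> and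
    \<open>B\<close> equate the resulting expressions for \<open>t\<close>.\<close>
  have A: "1 * (1 * f4 j + (- f4 x) * f1 j) + (- 1) * (1 * f5 j + (- f5 y) * f2 j) = 0" for j
    by (rule zero[OF comb[OF comb[OF f4(1) f1(1), unfolded un] comb[OF f5(1) f2(1), unfolded un],
            unfolded un]]) auto
  have B: "1 * (1 * f4 j + (- f4 x) * f1 j) + (- 1) * (1 * f6 j + (- f6 z) * f3 j) = 0" for j
    by (rule zero[OF comb[OF comb[OF f4(1) f1(1), unfolded un] comb[OF f6(1) f3(1), unfolded un],
            unfolded un]]) auto
  \<comment> \<open>The same substitution in the relation of the line \<open>x y z\<close>.\<close>
  have D: "1 * (1 * f7 j + (- f7 x) * f1 j) + (- 1) * (f7 y * f2 j + 1 * f3 j) = 0" for j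
    by (rule zero[OF comb[OF comb[OF f7(1) f1(1), unfolded un] comb[OF f2(1) f3(1), unfolded un],
            unfolded un]]) auto
  have "f4 r + f5 y * f2 r = f4 r + f6 z * f3 r"
    using A[of r] B[of r] by simp
  then have eqs: "f4 x * f1 p = f5 y * f2 p" "f4 x * f1 q = f6 z * f3 q" "f5 y * f2 r = f6 z * f3 r"
    using A[of p] B[of q] by (auto simp: algebra_simps)
  have "f7 x * f1 p = - (f7 y * f2 p)" "f7 x * f1 q = - f3 q" "f7 y * f2 r = - f3 r"
    using D[of p] D[of q] D[of r] by (auto simp: algebra_simps eq_neg_iff_add_eq_0 neg_eq_iff_add_eq_0)
  \<comment> \<open>Multiplying an equation from \<open>D\<close> by one from \<open>A\<close> and
    \<open>B\<close> produces a common factor of corner coefficients, which is nonzero and cancels.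
    The next two identities arise in the same way at the other corners.\<close>
  have xy: "f7 x * f5 y = - (f7 y * f4 x)"
  proof -
    have "f1 p * f2 p * (f7 x * f5 y) = (f7 x * f1 p) * (f5 y * f2 p)" by simp
    also have "\<dots> = - (f7 y * f2 p) * (f4 x * f1 p)"
      using eqs \<open>f7 x * f1 p = - (f7 y * f2 p)\<close> by simp
    also have "\<dots> = f1 p * f2 p * (- (f7 y * f4 x))" by simp
    finally show ?thesis
      using f1(2) f2(2) by (subst (asm) mult_left_cancel) auto
  qed
  have xz: "f7 x * f6 z = - f4 x"
  proof -
    have "f1 q * f3 q * (f7 x * f6 z) = (f7 x * f1 q) * (f6 z * f3 q)" by simp
    also have "\<dots> = - f3 q * (f4 x * f1 q)"
      using eqs \<open>f7 x * f1 q = - f3 q\<close> by simp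
    also have "\<dots> = f1 q * f3 q * (- f4 x)" by simp
    finally show ?thesis
      using f1(3) f3(2) by (subst (asm) mult_left_cancel) auto
  qed
  have yz: "f7 y * f6 z = - f5 y"
  proof -
    have "f2 r * f3 r * (f7 y * f6 z) = (f7 y * f2 r) * (f6 z * f3 r)" by simp
    also have "\<dots> = - f3 r * (f5 y * f2 r)"
      using eqs \<open>f7 y * f2 r = - f3 r\<close> by simp
    also have "\<dots> = f2 r * f3 r * (- f5 y)" by simp
    finally show ?thesis
      using f2(3) f3(3) by (subst (asm) mult_left_cancel) auto
  qed
  \<comment> \<open>Through \<open>yz\<close> and \<open>xy\<close> the product equals
    \<open>f7 y * f4 x\<close>, through \<open>xz\<close> it equals the negative of that, so its
    double is zero.\<close>
  have "f7 x * f7 y * f6 z = f7 y * f4 x"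
    using xy by (simp add: mult.assoc yz)
  moreover have "f7 x * f7 y * f6 z = f7 y * (f7 x * f6 z)"
    by (simp only: ac_simps)
  ultimately have "2 * (f7 x * f7 y * f6 z) = 0"
    unfolding mult_2 by (simp add: xz)
  then show False
    using two f7 f6 by simp
qed

section \<open>Contraction to a small coordinate space\<close>

text \<open>Padding with zeros lets spaces of different dimensions share one type, so that the
  contraction can be an ordinary function from length \<open>m\<close> to length
  \<open>d\<close>.\<close>

definition vecs :: "nat \<Rightarrow> (nat \<Rightarrow> 'a::zero) set" where
  "vecs m = {v. \<forall>i\<ge>m. v i = 0}"

definition fscale :: "'a::times \<Rightarrow> ('i \<Rightarrow> 'a) \<Rightarrow> 'i \<Rightarrow> 'a" where
  "fscale c v = (\<lambda>i. c * v i)"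

lemma fscale_apply [simp]: "fscale c v i = c * v i"
  by (simp add: fscale_def)

interpretation fvs: vector_space "fscale :: 'a::field \<Rightarrow> ('i \<Rightarrow> 'a) \<Rightarrow> 'i \<Rightarrow> 'a"
  by standard (simp_all add: fun_eq_iff algebra_simps)

lemma sum_fun_apply [simp]: "(\<Sum>x\<in>S. g x) i = (\<Sum>x\<in>S. g x i)"
  by (induction S rule: infinite_finite_induct) simp_all

lemma family_indep_iff_fscale:
  "family_indep w J \<longleftrightarrow> (\<forall>c. (\<Sum>j\<in>J. fscale (c j) (w j)) = 0 \<longrightarrow> (\<forall>j\<in>J. c j = 0))"
  by (simp add: family_indep_def fun_eq_iff)

lemma subspace_vecs: "fvs.subspace (vecs m)"
  by (rule fvs.subspaceI) (simp_all add: vecs_def)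

section \<open>Fibre counts, hyperplanes and vanishing functionals\<close>

lemma card_vecs: "card (vecs m :: (nat \<Rightarrow> 'a::{zero, finite}) set) = CARD('a) ^ m"
proof -
  have "bij_betw (\<lambda>v. restrict v {..<m}) (vecs m) ({..<m} \<rightarrow>\<^sub>E (UNIV :: 'a set))"
    by (rule bij_betw_byWitness[where f' = "\<lambda>g i. if i < m then g i else 0"])
      (auto simp: vecs_def fun_eq_iff PiE_def extensional_def)
  then show ?thesis
    by (simp add: bij_betw_same_card card_PiE)
qed

lemma finite_vecs: "finite (vecs m :: (nat \<Rightarrow> 'a::{zero, finite}) set)"
proof (rule card_ge_0_finite)
  show "0 < card (vecs m :: (nat \<Rightarrow> 'a) set)"
    by (simp add: card_vecs)
qed

text \<open>Translation injects any fibre into any other, so all fibres over \<open>W\<close> have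
  the same size. Neither linearity of \<open>\<psi>\<close> nor a kernel has to be
  mentioned.\<close>

lemma card_fibre:
  fixes \<psi> :: "'v::cancel_semigroup_add \<Rightarrow> 'w"
  assumes V: "finite V" and W: "finite W" "\<psi> ` V \<subseteq> W"
    and transl: "\<And>x y. x \<in> W \<Longrightarrow> y \<in> W \<Longrightarrow> \<exists>t. \<forall>v\<in>V. \<psi> v = x \<longrightarrow> v + t \<in> V \<and> \<psi> (v + t) = y"
    and x: "x \<in> W"
  shows "card W * card {v \<in> V. \<psi> v = x} = card V"
proof -
  have le: "card {v \<in> V. \<psi> v = y} \<le> card {v \<in> V. \<psi> v = z}" if "y \<in> W" "z \<in> W" for y z
  proof -
    obtain t where t: "\<forall>v\<in>V. \<psi> v = y \<longrightarrow> v + t \<in> V \<and> \<psi> (v + t) = z"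
      using transl[OF \<open>y \<in> W\<close> \<open>z \<in> W\<close>] by blast
    show ?thesis
      by (rule card_inj_on_le[of "\<lambda>v. v + t"]) (use t V in \<open>auto simp: inj_on_def\<close>)
  qed
  have "card V = card (\<Union>y\<in>W. {v \<in> V. \<psi> v = y})"
    using W by (intro arg_cong[of _ _ card]) auto
  also have "\<dots> = (\<Sum>y\<in>W. card {v \<in> V. \<psi> v = y})"
    using V W by (intro card_UN_disjoint) auto
  also have "\<dots> = (\<Sum>y\<in>W. card {v \<in> V. \<psi> v = x})"
    using le x by (intro sum.cong) (auto intro: antisym)
  finally show ?thesis
    by simp
qed

lemma card_hyperplane:
  fixes y :: "nat \<Rightarrow> 'a::{field, finite}"
  assumes "y \<in> vecs m" "y \<noteq> 0"
  shows "CARD('a) * card {v \<in> vecs m. (\<Sum>i<m. y i * v i) = 0} = CARD('a) ^ m"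
proof -
  obtain l where l: "l < m" "y l \<noteq> 0"
  proof -
    from assms(2) obtain l where "y l \<noteq> 0"
      by (auto simp: fun_eq_iff)
    moreover from this have "l < m"
      using assms(1) by (cases "l < m") (simp_all add: vecs_def)
    ultimately show ?thesis
      using that by blast
  qed
  have "card (UNIV :: 'a set) * card {v \<in> vecs m. (\<Sum>i<m. y i * v i) = 0} =
      card (vecs m :: (nat \<Rightarrow> 'a) set)"
  proof (rule card_fibre)
    fix a b :: 'a
    \<comment> \<open>Moving a single coordinate at which \<open>y\<close> is nonzero shifts the
      value from \<open>a\<close> to \<open>b\<close>.\<close>
    define t where "t = (\<lambda>i. if i = l then (b - a) / y l else 0)"
    have "t \<in> vecs m"
      using l by (simp add: t_def vecs_def)
    moreover have "(\<Sum>i<m. y i * t i) = b - a"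
      using l by (subst sum.remove[of _ l]) (auto simp: t_def)
    ultimately show "\<exists>t. \<forall>v\<in>vecs m. (\<Sum>i<m. y i * v i) = a \<longrightarrow>
        v + t \<in> vecs m \<and> (\<Sum>i<m. y i * (v + t) i) = b"
      by (intro exI[of _ t]) (auto simp: vecs_def distrib_left sum.distrib)
  qed (auto intro: finite_vecs)
  then show ?thesis
    by (simp add: card_vecs)
qed

text \<open>Take \<open>u\<close> outside the span, complete it together with a basis of the span to
  a basis, and read off the \<open>u\<close>-coordinate. The functional is written as a dot product
  with a vector \<open>y\<close> so that a union bound can run over the finitely many
  \<open>y\<close>.\<close>

lemma functional_vanishing:
  fixes S :: "(nat \<Rightarrow> 'a::field) set"
  assumes S: "S \<subseteq> vecs m" and ns: "\<not> vecs m \<subseteq> fvs.span S"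
  shows "\<exists>y\<in>vecs m. y \<noteq> 0 \<and> (\<forall>v\<in>S. (\<Sum>i<m. y i * v i) = 0)"
proof -
  from ns obtain u where u: "u \<in> vecs m" "u \<notin> fvs.span S"
    by blast
  obtain B where B: "B \<subseteq> S" "fvs.independent B" "S \<subseteq> fvs.span B"
    using fvs.maximal_independent_subset by blast
  have spanB: "fvs.span B = fvs.span S"
    using B by (metis fvs.span_mono fvs.span_minimal fvs.subspace_span subset_antisym)
  have uB: "fvs.independent (insert u B)"
    using B u spanB by (simp add: fvs.independent_insert)
  \<comment> \<open>This is a basis of the whole function space; only the values of its
    \<open>u\<close>-coordinate on the unit vectors below \<open>m\<close> enter
    \<open>y\<close>.\<close>
  define E where "E = fvs.extend_basis (insert u B)"
  have E: "fvs.independent E" "fvs.span E = UNIV" "insert u B \<subseteq> E"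
    using fvs.independent_extend_basis[OF uB] fvs.span_extend_basis[OF uB]
      fvs.extend_basis_superset[OF uB]
    by (simp_all add: E_def)
  define \<phi> where "\<phi> = (\<lambda>v. fvs.representation E v u)"
  define e :: "nat \<Rightarrow> nat \<Rightarrow> 'a" where "e = (\<lambda>i l. of_bool (i = l))"
  define y where "y = (\<lambda>i. if i < m then \<phi> (e i) else 0)"
  have \<phi>: "\<phi> v = (\<Sum>i<m. y i * v i)" if "v \<in> vecs m" for v
  proof -
    have "v = (\<Sum>i<m. fscale (v i) (e i))"
    proof
      show "v l = (\<Sum>i<m. fscale (v i) (e i)) l" for l
        using that by (cases "l < m") (simp_all add: e_def vecs_def)
    qed
    then have "\<phi> v = fvs.representation E (\<Sum>i<m. fscale (v i) (e i)) u"
      unfolding \<phi>_def by (rule arg_cong)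
    also have "\<dots> = (\<Sum>i<m. v i * \<phi> (e i))"
      using E by (simp add: fvs.representation_sum fvs.representation_scale \<phi>_def)
    finally show ?thesis
      by (simp add: y_def mult.commute)
  qed
  have "\<phi> u = 1"
    using E by (simp add: \<phi>_def fvs.representation_basis)
  then have "y \<noteq> 0"
    using \<phi>[OF u(1)] by auto
  moreover have "y \<in> vecs m"
    by (simp add: y_def vecs_def)
  moreover have "(\<Sum>i<m. y i * v i) = 0" if "v \<in> S" for v
  proof -
    have "v \<in> fvs.span B"
      using that spanB fvs.span_base by blast
    then have "fvs.representation E v = fvs.representation B v"
      using E by (intro fvs.representation_extend) auto
    moreover have "u \<notin> B"
      using B u fvs.span_base by blast
    ultimately have "\<phi> v = 0"
      using fvs.representation_ne_zero[of B v u] by (auto simp: \<phi>_def)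
    then show ?thesis
      using \<phi> that S by auto
  qed
  ultimately show ?thesis
    by blast
qed

text \<open>\<open>\<rho>\<close> is the quotient map by the span of the contracted columns, in
  coordinates. \<open>C\<close> and \<open>\<rho>\<close> are chosen from the first \<open>k\<close>
  columns alone and serve every continuation \<open>h\<close>; the equal fibres say that
  \<open>\<rho>\<close> of a uniform vector is uniform.\<close>

lemma spanning_contraction:
  fixes f :: "nat \<Rightarrow> nat \<Rightarrow> 'a::{field, finite}"
  assumes f: "f ` {..<k} \<subseteq> vecs m" and span: "vecs m \<subseteq> fvs.span (f ` {..<k})" and d: "d \<le> m"
  obtains C and \<rho> :: "(nat \<Rightarrow> 'a) \<Rightarrow> nat \<Rightarrow> 'a" where "C \<subseteq> {..<k}"
    "\<And>h T. (\<And>j. j < k \<Longrightarrow> h j = f j) \<Longrightarrow> finite T \<Longrightarrow> C \<inter> T = {} \<Longrightarrow> h ` T \<subseteq> vecs m \<Longrightarrow>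
      family_indep h (C \<union> T) \<longleftrightarrow> family_indep (\<lambda>j. \<rho> (h j)) T"
    "\<And>x. x \<in> vecs d \<Longrightarrow> CARD('a) ^ d * card {v \<in> vecs m. \<rho> v = x} = CARD('a) ^ m"
proof -
  obtain B where B: "B \<subseteq> f ` {..<k}" "fvs.independent B" "f ` {..<k} \<subseteq> fvs.span B"
    using fvs.maximal_independent_subset by blast
  have finB: "finite B"
    using B(1) finite_subset by blast
  have spanB: "fvs.span B = vecs m"
  proof
    show "fvs.span B \<subseteq> vecs m"
      using B f subspace_vecs by (intro fvs.span_minimal) auto
    show "vecs m \<subseteq> fvs.span B"
      using span B by (meson fvs.span_minimal fvs.subspace_span order_trans)
  qed
  have expand: "v = (\<Sum>b\<in>B. fscale (fvs.representation B v b) b)" if "v \<in> vecs m" for v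
    using that B finB spanB by (simp add: fvs.sum_representation_eq)
  \<comment> \<open>Comparing cardinalities suffices: coordinate tuples over \<open>B\<close> map
    onto \<open>vecs m\<close>.\<close>
  have "d \<le> card B"
  proof -
    have "vecs m \<subseteq> (\<lambda>g. \<Sum>b\<in>B. fscale (g b) b) ` (B \<rightarrow>\<^sub>E UNIV)"
    proof
      fix v :: "nat \<Rightarrow> 'a" assume "v \<in> vecs m"
      then have "v = (\<Sum>b\<in>B. fscale (restrict (fvs.representation B v) B b) b)"
        using expand by simp
      then show "v \<in> (\<lambda>g. \<Sum>b\<in>B. fscale (g b) b) ` (B \<rightarrow>\<^sub>E UNIV)"
        by (rule image_eqI[where x = "restrict (fvs.representation B v) B"]) simp
    qed
    then have "card (vecs m :: (nat \<Rightarrow> 'a) set) \<le> card (B \<rightarrow>\<^sub>E (UNIV :: 'a set))"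
      by (rule surj_card_le[rotated]) (use finB in \<open>simp add: finite_PiE\<close>)
    then have "CARD('a) ^ m \<le> CARD('a) ^ card B"
      using finB by (simp add: card_vecs card_PiE)
    moreover have "1 < CARD('a)"
      using card_mono[of UNIV "{0, 1 :: 'a}"] by simp
    ultimately show ?thesis
      using d by (simp add: power_increasing_iff)
  qed
  then obtain D where D: "D \<subseteq> B" "card D = d"
    by (meson obtain_subset_with_card_n)
  have finD: "finite D"
    using D finB finite_subset by blast
  obtain b where b: "bij_betw b {..<d} D"
    using D finD by (metis atLeast0LessThan ex_bij_betw_nat_finite)
  have bB: "b i \<in> B" if "i < d" for i
    using that b D by (auto simp: bij_betw_def)
  \<comment> \<open>Columns may repeat, so one index is selected for each basis vector to be
    contracted.\<close>
  obtain C where C: "C \<subseteq> {..<k}" "inj_on f C" "B - D = f ` C"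
    using B(1) subset_image_inj[of "B - D" f "{..<k}"] by auto
  have finC: "finite C"
    using C finite_subset by blast
  define R where "R = fvs.representation B"
  have R_add: "R (v + w) x = R v x + R w x" if "v \<in> vecs m" "w \<in> vecs m" for v w x
    using that B spanB by (simp add: R_def fvs.representation_add)
  have R_sum: "R (\<Sum>j\<in>T. fscale (c j) (h j)) x = (\<Sum>j\<in>T. c j * R (h j) x)"
    if "h ` T \<subseteq> vecs m" for h :: "nat \<Rightarrow> _" and T c x
  proof -
    have *: "h j \<in> fvs.span B" if "j \<in> T" for j
      using that \<open>h ` T \<subseteq> vecs m\<close> spanB by auto
    have "R (\<Sum>j\<in>T. fscale (c j) (h j)) x = (\<Sum>j\<in>T. R (fscale (c j) (h j)) x)"
      unfolding R_def using * by (simp add: fvs.representation_sum[OF B(2)] fvs.span_scale)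
    also have "\<dots> = (\<Sum>j\<in>T. c j * R (h j) x)"
      unfolding R_def using * by (intro sum.cong) (simp_all add: fvs.representation_scale[OF B(2)])
    finally show ?thesis .
  qed
  have R_basis: "R v x = of_bool (x = v)" if "v \<in> B" for v x
    using that B by (simp add: R_def fvs.representation_basis)
  define \<rho> where "\<rho> = (\<lambda>v i. if i < d then R v (b i) else 0)"
  show thesis
  proof (rule that[of C \<rho>])
    show "C \<subseteq> {..<k}"
      by fact
  next
    fix h :: "nat \<Rightarrow> nat \<Rightarrow> 'a" and T
    assume hf: "\<And>j. j < k \<Longrightarrow> h j = f j" and T: "finite T" "C \<inter> T = {}" "h ` T \<subseteq> vecs m"
    have hC: "h j = f j" if "j \<in> C" for j
      using that C hf by auto
    have hCB: "h j \<in> B" "h j \<notin> D" if "j \<in> C" for j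
      using that C hC[OF that] by auto
    have injh: "inj_on h C" and imh: "h ` C = B - D"
      using C hC by (auto simp: inj_on_def)
    show "family_indep h (C \<union> T) \<longleftrightarrow> family_indep (\<lambda>j. \<rho> (h j)) T"
    proof
      assume ind: "family_indep h (C \<union> T)"
      show "family_indep (\<lambda>j. \<rho> (h j)) T"
        unfolding family_indep_def
      proof (intro allI impI)
        fix c assume c: "\<forall>i. (\<Sum>j\<in>T. c j * \<rho> (h j) i) = 0"
        define u where "u = (\<Sum>j\<in>T. fscale (c j) (h j))"
        have u: "u \<in> vecs m"
          unfolding u_def using T subspace_vecs
          by (intro fvs.subspace_sum fvs.subspace_scale) auto
        have "R u (b i) = 0" if "i < d" for i
          using c[rule_format, of i] that T(3) by (simp add: u_def R_sum \<rho>_def)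
        then have RD: "R u x = 0" if "x \<in> D" for x
          using that b by (auto simp: bij_betw_def)
        have "u = (\<Sum>x\<in>B. fscale (R u x) x)"
          unfolding R_def using expand[OF u] .
        also have "\<dots> = (\<Sum>x\<in>h ` C. fscale (R u x) x)"
          using finB D RD unfolding imh by (intro sum.mono_neutral_right) (auto simp: fun_eq_iff)
        also have "\<dots> = (\<Sum>j\<in>C. fscale (R u (h j)) (h j))"
          using injh by (simp add: sum.reindex)
        finally have uC: "u = (\<Sum>j\<in>C. fscale (R u (h j)) (h j))" .
        \<comment> \<open>A combination over \<open>T\<close> that \<open>\<rho>\<close> kills has
          no coordinates in \<open>D\<close>, hence equals a combination of the columns in
          \<open>C\<close>. Subtracting that one gives a relation on
          \<open>C \<union> T\<close>.\<close>
        define c' where "c' = (\<lambda>j. if j \<in> T then c j else - R u (h j))"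
        have "(\<Sum>j\<in>C \<union> T. fscale (c' j) (h j)) =
            (\<Sum>j\<in>C. fscale (c' j) (h j)) + (\<Sum>j\<in>T. fscale (c' j) (h j))"
          using finC T by (intro sum.union_disjoint) auto
        also have "(\<Sum>j\<in>C. fscale (c' j) (h j)) = (\<Sum>j\<in>C. - fscale (R u (h j)) (h j))"
          using T by (intro sum.cong) (auto simp: c'_def fun_eq_iff)
        also have "\<dots> = - u"
          using uC by (simp add: sum_negf)
        also have "(\<Sum>j\<in>T. fscale (c' j) (h j)) = u"
          unfolding u_def by (intro sum.cong) (auto simp: c'_def)
        also have "- u + u = 0"
          by (rule left_minus)
        finally have "(\<Sum>j\<in>C \<union> T. fscale (c' j) (h j)) = 0" .
        then have "\<forall>j\<in>C \<union> T. c' j = 0"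
          using ind unfolding family_indep_iff_fscale by blast
        then show "\<forall>j\<in>T. c j = 0"
          unfolding c'_def by (metis UnI2)
      qed
    next
      assume ind: "family_indep (\<lambda>j. \<rho> (h j)) T"
      show "family_indep h (C \<union> T)"
        unfolding family_indep_iff_fscale
      proof (intro allI impI)
        fix c assume c: "(\<Sum>j\<in>C \<union> T. fscale (c j) (h j)) = 0"
        have hV: "h ` (C \<union> T) \<subseteq> vecs m"
          using T(3) hCB(1) unfolding spanB[symmetric] by (auto intro: fvs.span_base)
        have "(\<Sum>j\<in>T. c j * \<rho> (h j) i) = 0" for i
        proof (cases "i < d")
          case True
          have "0 = R (\<Sum>j\<in>C \<union> T. fscale (c j) (h j)) (b i)"
            unfolding c R_def by (simp add: fvs.representation_zero)
          also have "\<dots> = (\<Sum>j\<in>C \<union> T. c j * R (h j) (b i))"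
            by (rule R_sum[OF hV])
          also have "\<dots> = (\<Sum>j\<in>C. c j * R (h j) (b i)) + (\<Sum>j\<in>T. c j * R (h j) (b i))"
            using finC T by (intro sum.union_disjoint) auto
          \<comment> \<open>The columns in \<open>C\<close> are basis vectors outside
            \<open>D\<close>, so their \<open>D\<close>-coordinates vanish.\<close>
          also have "(\<Sum>j\<in>C. c j * R (h j) (b i)) = 0"
          proof (rule sum.neutral, intro ballI)
            fix j assume "j \<in> C"
            moreover have "b i \<in> D"
              using True b by (auto simp: bij_betw_def)
            ultimately show "c j * R (h j) (b i) = 0"
              using hCB[of j] by (auto simp: R_basis)
          qed
          finally show ?thesis
            using True by (simp add: \<rho>_def)
        qed (simp add: \<rho>_def)
        then have cT: "\<forall>j\<in>T. c j = 0"
          using ind unfolding family_indep_def by blast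
        have "(\<Sum>j\<in>C \<union> T. fscale (c j) (h j)) = (\<Sum>j\<in>C. fscale (c j) (h j))"
          using cT finC T by (intro sum.mono_neutral_right) (auto simp: fun_eq_iff)
        then have "(\<Sum>j\<in>C. fscale (c j) (h j)) = 0"
          using c by simp
        moreover have "(\<Sum>x\<in>h ` C. fscale (c (the_inv_into C h x)) x) = (\<Sum>j\<in>C. fscale (c j) (h j))"
          using injh by (simp add: sum.reindex the_inv_into_f_f)
        ultimately have zero: "(\<Sum>x\<in>h ` C. fscale (c (the_inv_into C h x)) x) = 0"
          by simp
        have "c (the_inv_into C h x) = 0" if "x \<in> h ` C" for x
          by (rule fvs.independentD[OF B(2) _ _ zero that]) (simp_all add: imh finB)
        then have "\<forall>j\<in>C. c j = 0"
          using injh by (metis imageI the_inv_into_f_f)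
        then show "\<forall>j\<in>C \<union> T. c j = 0"
          using cT by blast
      qed
    qed
  next
    fix x :: "nat \<Rightarrow> 'a"
    assume x: "x \<in> vecs d"
    have "card (vecs d :: (nat \<Rightarrow> 'a) set) * card {v \<in> vecs m. \<rho> v = x} =
        card (vecs m :: (nat \<Rightarrow> 'a) set)"
    proof (rule card_fibre)
      fix y z :: "nat \<Rightarrow> 'a"
      assume yz: "y \<in> vecs d" "z \<in> vecs d"
      \<comment> \<open>Shifting along the retained basis vectors moves the fibre over
        \<open>y\<close> into the fibre over \<open>z\<close>.\<close>
      define t where "t = (\<Sum>i<d. fscale (z i - y i) (b i))"
      have bV: "b ` {..<d} \<subseteq> vecs m"
        using bB spanB fvs.span_base by auto
      then have t: "t \<in> vecs m"
        unfolding t_def using subspace_vecs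
        by (intro fvs.subspace_sum fvs.subspace_scale) auto
      have Rt: "R t (b i) = z i - y i" if "i < d" for i
      proof -
        have "R t (b i) = (\<Sum>l<d. (z l - y l) * R (b l) (b i))"
          unfolding t_def by (rule R_sum[OF bV])
        also have "\<dots> = (\<Sum>l<d. (z l - y l) * of_bool (i = l))"
          using b bB that by (intro sum.cong) (auto simp: R_basis bij_betw_def inj_on_eq_iff)
        also have "\<dots> = z i - y i"
          using that by simp
        finally show ?thesis .
      qed
      have "v + t \<in> vecs m \<and> \<rho> (v + t) = z" if "v \<in> vecs m" "\<rho> v = y" for v
      proof
        show "v + t \<in> vecs m"
          using that t subspace_vecs fvs.subspace_add by blast
        show "\<rho> (v + t) = z"
        proof
          fix i
          show "\<rho> (v + t) i = z i"
            using that(2)[symmetric] yz that(1) t by (cases "i < d") (auto simp: \<rho>_def R_add Rt vecs_def)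
        qed
      qed
      then show "\<exists>t. \<forall>v\<in>vecs m. \<rho> v = y \<longrightarrow> v + t \<in> vecs m \<and> \<rho> (v + t) = z"
        by blast
    qed (use x in \<open>auto simp: \<rho>_def vecs_def finite_vecs intro: finite_vecs[unfolded vecs_def]\<close>)
    then show "CARD('a) ^ d * card {v \<in> vecs m. \<rho> v = x} = CARD('a) ^ m"
      by (simp add: card_vecs)
  qed
qed

section \<open>Excluded minors found in a full plane or space\<close>

lemma family_indep_pair:
  assumes "u \<noteq> v" "\<And>a b. (\<And>i. a * w u i + b * w v i = 0) \<Longrightarrow> a = 0 \<and> b = 0"
  shows "family_indep w {u, v}"
  unfolding family_indep_def
proof (intro allI impI)
  fix c assume "\<forall>i. (\<Sum>j\<in>{u, v}. c j * w j i) = 0"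
  then have "c u * w u i + c v * w v i = 0" for i
    using assms(1) by simp
  then show "\<forall>j\<in>{u, v}. c j = 0"
    using assms(2)[of "c u" "c v"] by simp
qed

lemma not_family_indep_triple:
  assumes "u \<noteq> v" "u \<noteq> x" "v \<noteq> x" "c \<noteq> 0" "\<And>i. a * w u i + b * w v i + c * w x i = 0"
  shows "\<not> family_indep w {u, v, x}"
proof
  assume "family_indep w {u, v, x}"
  then have "\<forall>j\<in>{u, v, x}. (if j = u then a else if j = v then b else c) = 0"
    unfolding family_indep_def using assms
    by (elim allE[of _ "\<lambda>j. if j = u then a else if j = v then b else c"]) (auto simp: add.assoc)
  then show False
    using assms by auto
qed

definition plane_vec :: "'a \<Rightarrow> 'a \<Rightarrow> nat \<Rightarrow> 'a::zero" where
  "plane_vec a b = (\<lambda>i. if i = 0 then a else if i = 1 then b else 0)"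

lemma plane_vec_index [simp]: "plane_vec a b 0 = a" "plane_vec a b (Suc 0) = b"
  by (simp_all add: plane_vec_def)

lemma plane_vec_vecs: "plane_vec a b \<in> vecs 2"
  by (simp add: plane_vec_def vecs_def)

lemma plane_vec_eq_iff: "plane_vec a b = plane_vec a' b' \<longleftrightarrow> a = a' \<and> b = b'"
  by (metis plane_vec_index)

text \<open>By \<open>contr\<close>, \<open>w\<close> represents the contraction by \<open>C\<close>
  on the columns from \<open>k\<close> on. Among its values are (1,0), (0,1), (1,1) and
  (1,\<open>\<tau>\<close>), four pairwise independent vectors of a plane.\<close>

lemma not_graphic_of_plane:
  fixes A :: "'a::{field, finite} mat"
  assumes q: "CARD('a) > 2"
    and C: "C \<subseteq> {..<k}" and k: "k \<le> dim_col A"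
    and contr: "\<And>T. T \<subseteq> {k..<dim_col A} \<Longrightarrow> indep_columns A (C \<union> T) \<longleftrightarrow> family_indep w T"
    and onto: "\<And>x. x \<in> vecs 2 \<Longrightarrow> \<exists>j\<in>{k..<dim_col A}. w j = (x :: nat \<Rightarrow> 'a)"
  shows "\<not> graphic (column_matroid A)"
proof
  assume "graphic (column_matroid A)"
  then obtain g :: "nat \<Rightarrow> nat \<Rightarrow> bit"
    where g: "\<And>J. J \<subseteq> {..<dim_col A} \<Longrightarrow> indep_columns A J \<longleftrightarrow> family_indep g J"
    by (rule graphic_represented) blast
  have contr': "family_indep g (C \<union> T) \<longleftrightarrow> family_indep w T" if "T \<subseteq> {k..<dim_col A}" for T
  proof -
    have "C \<union> T \<subseteq> {..<dim_col A}"
      using that C k by auto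
    then show ?thesis
      using g contr[OF that] by blast
  qed
  \<comment> \<open>This is where more than two field elements are needed: the fourth
    direction.\<close>
  have "\<exists>\<tau>::'a. \<tau> \<noteq> 0 \<and> \<tau> \<noteq> 1"
  proof (rule ccontr)
    assume "\<not> ?thesis"
    then have "(UNIV :: 'a set) \<subseteq> {0, 1}"
      by auto
    then have "CARD('a) \<le> card {0, 1 :: 'a}"
      by (intro card_mono) auto
    then show False
      using q by simp
  qed
  then obtain \<tau> :: 'a where \<tau>: "\<tau> \<noteq> 0" "\<tau> \<noteq> 1"
    by blast
  obtain p where p: "p \<in> {k..<dim_col A}" "w p = plane_vec 1 0" using onto plane_vec_vecs by meson
  obtain q where q: "q \<in> {k..<dim_col A}" "w q = plane_vec 0 1" using onto plane_vec_vecs by meson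
  obtain r where r: "r \<in> {k..<dim_col A}" "w r = plane_vec 1 1" using onto plane_vec_vecs by meson
  obtain s where s: "s \<in> {k..<dim_col A}" "w s = plane_vec 1 \<tau>" using onto plane_vec_vecs by meson
  have dist: "distinct (map w [p, q, r, s])"
    using \<tau> by (simp add: p q r s plane_vec_eq_iff)
  then have ne: "distinct [p, q, r, s]"
    unfolding distinct_map by blast
  have pair: "family_indep w {u, v}" if "u \<in> {p, q, r, s}" "v \<in> {p, q, r, s}" "u \<noteq> v" for u v
  proof (rule family_indep_pair[OF that(3)])
    fix a b assume "\<And>i. a * w u i + b * w v i = 0"
    from this[of 0] this[of 1] that \<tau> show "a = 0 \<and> b = 0"
      by (auto simp: p q r s add_eq_0_iff)
  qed
  have "\<not> family_indep w {p, q, r}"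
    by (rule not_family_indep_triple[where a = 1 and b = 1 and c = "- 1"])
      (use ne in \<open>auto simp: p q r plane_vec_def\<close>)
  moreover have "\<not> family_indep w {p, q, s}"
    by (rule not_family_indep_triple[where a = 1 and b = \<tau> and c = "- 1"])
      (use ne in \<open>auto simp: p q s plane_vec_def\<close>)
  ultimately have dep: "\<not> family_indep g (C \<union> {p, q, r})" "\<not> family_indep g (C \<union> {p, q, s})"
    using contr'[of "{p, q, r}"] contr'[of "{p, q, s}"] p q r s by simp_all
  have pair': "family_indep g (C \<union> {u, v})"
    if "u \<in> {p, q, r, s}" "v \<in> {p, q, r, s}" "u \<noteq> v" for u v
  proof -
    have "{u, v} \<subseteq> {k..<dim_col A}"
      using that p q r s by blast
    then show ?thesis
      using contr' pair[OF that] by blast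
  qed
  have "finite C" "C \<inter> {p, q, r, s} = {}"
    using C p q r s by (auto intro: finite_subset)
  then show False
    using no_binary_U24[OF _ _ ne pair' dep] by blast
qed

definition space_vec :: "'a \<Rightarrow> 'a \<Rightarrow> 'a \<Rightarrow> nat \<Rightarrow> 'a::zero" where
  "space_vec a b c = (\<lambda>i. if i = 0 then a else if i = 1 then b else if i = 2 then c else 0)"

lemma space_vec_index [simp]:
  "space_vec a b c 0 = a" "space_vec a b c (Suc 0) = b" "space_vec a b c 2 = c"
  by (simp_all add: space_vec_def)

lemma space_vec_vecs: "space_vec a b c \<in> vecs 3"
  by (simp add: space_vec_def vecs_def)

lemma space_vec_eq_iff: "space_vec a b c = space_vec a' b' c' \<longleftrightarrow> a = a' \<and> b = b' \<and> c = c'"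
  by (metis space_vec_index)

text \<open>The seven nonzero vectors of length 3 over the two-element field form the Fano plane,
  whose lines are the triples with sum zero.\<close>

lemma not_graphic_of_space:
  fixes A :: "'a::{field, finite} mat"
  assumes q: "CARD('a) = 2"
    and C: "C \<subseteq> {..<k}" and k: "k \<le> dim_col A"
    and contr: "\<And>T. T \<subseteq> {k..<dim_col A} \<Longrightarrow> indep_columns A (C \<union> T) \<longleftrightarrow> family_indep w T"
    and onto: "\<And>x. x \<in> vecs 3 \<Longrightarrow> \<exists>j\<in>{k..<dim_col A}. w j = (x :: nat \<Rightarrow> 'a)"
  shows "\<not> graphic (column_matroid A)"
proof
  assume "graphic (column_matroid A)"
  then obtain g :: "nat \<Rightarrow> nat \<Rightarrow> real"
    where g: "\<And>J. J \<subseteq> {..<dim_col A} \<Longrightarrow> indep_columns A J \<longleftrightarrow> family_indep g J"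
    by (rule graphic_represented) blast
  have contr': "family_indep g (C \<union> T) \<longleftrightarrow> family_indep w T" if "T \<subseteq> {k..<dim_col A}" for T
  proof -
    have "C \<union> T \<subseteq> {..<dim_col A}"
      using that C k by auto
    then show ?thesis
      using g contr[OF that] by blast
  qed
  have "{0, 1 :: 'a} = UNIV"
    by (rule card_subset_eq) (use q in auto)
  then have el: "a = 0 \<or> a = 1" for a :: 'a
    by blast
  have two: "(1::'a) + 1 = 0"
    using el[of "1 + 1"] by (metis add_cancel_left_right zero_neq_one)
  have neg: "- a = a" for a :: 'a
    using el[of a] two by (auto simp: minus_unique)
  obtain p where p: "p \<in> {k..<dim_col A}" "w p = space_vec 1 0 0" using onto space_vec_vecs by meson
  obtain q where q: "q \<in> {k..<dim_col A}" "w q = space_vec 0 1 0" using onto space_vec_vecs by meson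
  obtain r where r: "r \<in> {k..<dim_col A}" "w r = space_vec 0 0 1" using onto space_vec_vecs by meson
  obtain x where x: "x \<in> {k..<dim_col A}" "w x = space_vec 1 1 0" using onto space_vec_vecs by meson
  obtain y where y: "y \<in> {k..<dim_col A}" "w y = space_vec 1 0 1" using onto space_vec_vecs by meson
  obtain z where z: "z \<in> {k..<dim_col A}" "w z = space_vec 0 1 1" using onto space_vec_vecs by meson
  obtain t where t: "t \<in> {k..<dim_col A}" "w t = space_vec 1 1 1" using onto space_vec_vecs by meson
  define P where "P = {p, q, r, x, y, z, t}"
  have Pk: "P \<subseteq> {k..<dim_col A}"
    using p q r x y z t by (simp add: P_def)
  have dist: "distinct (map w [p, q, r, x, y, z, t])"
    by (simp add: p q r x y z t space_vec_eq_iff)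
  then have ne: "distinct [p, q, r, x, y, z, t]" and "inj_on w (set [p, q, r, x, y, z, t])"
    unfolding distinct_map by blast+
  then have inj: "inj_on w P"
    unfolding P_def list.set by blast
  have nz: "w u \<noteq> (\<lambda>i. 0)" if "u \<in> P" for u
  proof -
    have "(\<lambda>i. 0 :: 'a) = space_vec 0 0 0"
      by (simp add: space_vec_def fun_eq_iff)
    then show ?thesis
      using that by (auto simp: P_def p q r x y z t space_vec_eq_iff)
  qed
  \<comment> \<open>With only the scalars 0 and 1, two vectors are independent once they are nonzero
    and distinct.\<close>
  have pair: "family_indep w {u, v}" if "u \<in> P" "v \<in> P" "u \<noteq> v" for u v
  proof (rule family_indep_pair[OF that(3)])
    fix a b assume ab: "\<And>i. a * w u i + b * w v i = 0"
    have "w u \<noteq> w v"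
      using inj that by (auto simp: inj_on_def)
    then have "\<not> (a = 1 \<and> b = 1)"
      using ab by (auto simp: fun_eq_iff add_eq_0_iff neg)
    moreover have "\<not> (a = 1 \<and> b = 0)" "\<not> (a = 0 \<and> b = 1)"
      using ab nz[OF that(1)] nz[OF that(2)] by (auto simp: fun_eq_iff)
    ultimately show "a = 0 \<and> b = 0"
      using el[of a] el[of b] by blast
  qed
  have pair': "family_indep g (C \<union> {u, v})" if "u \<in> P" "v \<in> P" "u \<noteq> v" for u v
  proof -
    have "{u, v} \<subseteq> {k..<dim_col A}"
      using that Pk by blast
    then show ?thesis
      using contr' pair[OF that] by blast
  qed
  have line: "\<not> family_indep g (C \<union> {u, v, s})"
    if "u \<in> P" "v \<in> P" "s \<in> P" "distinct [u, v, s]" "\<And>i. w u i + w v i + w s i = 0" for u v s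
  proof -
    have "{u, v, s} \<subseteq> {k..<dim_col A}"
      using that Pk by blast
    moreover have "\<not> family_indep w {u, v, s}"
      by (rule not_family_indep_triple[where a = 1 and b = 1 and c = 1]) (use that in auto)
    ultimately show ?thesis
      using contr' by blast
  qed
  have dep: "\<not> family_indep g (C \<union> {p, q, x})" "\<not> family_indep g (C \<union> {p, r, y})"
      "\<not> family_indep g (C \<union> {q, r, z})" "\<not> family_indep g (C \<union> {r, x, t})"
      "\<not> family_indep g (C \<union> {q, y, t})" "\<not> family_indep g (C \<union> {p, z, t})"
      "\<not> family_indep g (C \<union> {x, y, z})"
    by (rule line; (use ne in \<open>simp add: P_def; fail\<close> | simp add: p q r x y z t space_vec_def two[simplified]))+
  have "family_indep w {p, q, r}"
    unfolding family_indep_def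
  proof (intro allI impI)
    fix c assume "\<forall>i. (\<Sum>j\<in>{p, q, r}. c j * w j i) = 0"
    then have "c p * w p i + c q * w q i + c r * w r i = 0" for i
      using ne by (simp add: add.assoc)
    from this[of 0] this[of 1] this[of 2] show "\<forall>j\<in>{p, q, r}. c j = 0"
      by (simp add: p q r space_vec_def)
  qed
  then have ind3: "family_indep g (C \<union> {p, q, r})"
    using contr'[of "{p, q, r}"] p q r by simp
  have C': "finite C" "C \<inter> {p, q, r, x, y, z, t} = {}"
    using C Pk by (auto simp: P_def intro: finite_subset)
  show False
    by (rule no_fano[OF _ C' ne pair'[unfolded P_def] ind3 dep]) simp_all
qed

section \<open>Counting\<close>

lemma prod_lessThan_if:
  "k \<le> n \<Longrightarrow> (\<Prod>j<n. if j < k then a else b) = a ^ k * (b :: nat) ^ (n - k)"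
proof (induction n)
  case (Suc n)
  then show ?case
    by (cases "k = Suc n") (auto simp: Suc_diff_le algebra_simps)
qed simp

text \<open>A union bound over hyperplanes: fewer than \<open>q^m\<close> nonzero functionals
  \<open>y\<close>, each confining the first \<open>k\<close> columns to a set of density
  \<open>1/q\<close> apiece. The factor \<open>q^k\<close> is multiplied out to stay in the natural
  numbers.\<close>

lemma card_nonspanning:
  assumes "k \<le> n"
  shows "CARD('a::{field, finite}) ^ k *
      card {f \<in> {..<n} \<rightarrow>\<^sub>E (vecs m :: (nat \<Rightarrow> 'a) set). \<not> vecs m \<subseteq> fvs.span (f ` {..<k})}
    \<le> CARD('a) ^ m * (CARD('a) ^ m) ^ n"
    (is "?q ^ k * card ?Bad \<le> _")
proof -
  let ?V = "vecs m :: (nat \<Rightarrow> 'a) set"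
  let ?Y = "?V - {0}"
  define H where "H = (\<lambda>y. {v \<in> ?V. (\<Sum>i<m. y i * v i) = 0})"
  have finV: "finite ?V"
    by (rule finite_vecs)
  have sub: "?Bad \<subseteq> (\<Union>y\<in>?Y. PiE {..<n} (\<lambda>j. if j < k then H y else ?V))"
  proof
    fix f assume f: "f \<in> ?Bad"
    then have fV: "f \<in> {..<n} \<rightarrow>\<^sub>E ?V"
      by blast
    have fk: "f ` {..<k} \<subseteq> ?V"
      using PiE_mem[OF fV] assms by (simp add: image_subset_iff)
    have "\<not> ?V \<subseteq> fvs.span (f ` {..<k})"
      using f by simp
    then obtain y where y: "y \<in> ?V" "y \<noteq> 0" "\<And>v. v \<in> f ` {..<k} \<Longrightarrow> (\<Sum>i<m. y i * v i) = 0"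
      using functional_vanishing[OF fk] by blast
    have "f \<in> PiE {..<n} (\<lambda>j. if j < k then H y else ?V)"
    proof (rule PiE_I)
      show "f j \<in> (if j < k then H y else ?V)" if "j \<in> {..<n}" for j
        using PiE_mem[OF fV that] y(3)[of "f j"] by (simp add: H_def)
      show "f j = undefined" if "j \<notin> {..<n}" for j
        using PiE_arb[OF fV that] .
    qed
    then show "f \<in> (\<Union>y\<in>?Y. PiE {..<n} (\<lambda>j. if j < k then H y else ?V))"
      using y by blast
  qed
  have finP: "finite (PiE {..<n} (\<lambda>j. if j < k then H y else ?V))" for y
    using finV by (intro finite_PiE) (auto simp: H_def)
  have card: "?q ^ k * card (PiE {..<n} (\<lambda>j. if j < k then H y else ?V)) = (?q ^ m) ^ n"
    if "y \<in> ?Y" for y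
  proof -
    have "card (PiE {..<n} (\<lambda>j. if j < k then H y else ?V)) =
        (\<Prod>j<n. if j < k then card (H y) else card ?V)"
      by (simp add: card_PiE if_distrib)
    also have "\<dots> = card (H y) ^ k * card ?V ^ (n - k)"
      using assms by (rule prod_lessThan_if)
    finally have "?q ^ k * card (PiE {..<n} (\<lambda>j. if j < k then H y else ?V)) =
        (?q * card (H y)) ^ k * card ?V ^ (n - k)"
      by (simp add: power_mult_distrib)
    also have "?q * card (H y) = card ?V"
      using that card_hyperplane[of y m] by (simp add: H_def card_vecs)
    also have "card ?V ^ k * card ?V ^ (n - k) = (?q ^ m) ^ n"
      using assms by (simp add: card_vecs flip: power_add)
    finally show ?thesis .
  qed
  have "card ?Bad \<le> card (\<Union>y\<in>?Y. PiE {..<n} (\<lambda>j. if j < k then H y else ?V))"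
    using sub finV finP by (intro card_mono) auto
  also have "\<dots> \<le> (\<Sum>y\<in>?Y. card (PiE {..<n} (\<lambda>j. if j < k then H y else ?V)))"
    using finV by (intro card_UN_le) auto
  finally have "?q ^ k * card ?Bad \<le> (\<Sum>y\<in>?Y. ?q ^ k * card (PiE {..<n} (\<lambda>j. if j < k then H y else ?V)))"
    by (simp flip: sum_distrib_left)
  also have "\<dots> = (\<Sum>y\<in>?Y. (?q ^ m) ^ n)"
    by (rule sum.cong) (simp_all add: card)
  also have "\<dots> = card ?Y * (?q ^ m) ^ n"
    by simp
  also have "\<dots> \<le> ?q ^ m * (?q ^ m) ^ n"
    using card_mono[OF finV, of ?Y] by (intro mult_right_mono) (auto simp: card_vecs)
  finally show ?thesis .
qed

text \<open>Conditioning on the first \<open>k\<close> entries, done by counting: the forbidden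
  region \<open>W g x\<close> may depend on the prefix \<open>g\<close>, but its size is bounded
  uniformly by \<open>M\<close>.\<close>

lemma card_confined_tail:
  assumes V: "finite V" and X: "finite X" and G: "G \<subseteq> {..<k} \<rightarrow>\<^sub>E V"
    and W: "\<And>g x. g \<in> G \<Longrightarrow> x \<in> X \<Longrightarrow> W g x \<subseteq> V \<and> card (W g x) \<le> M" and "k \<le> n"
  shows "card {f \<in> {..<n} \<rightarrow>\<^sub>E V. restrict f {..<k} \<in> G \<and>
      (\<exists>x\<in>X. \<forall>j\<in>{k..<n}. f j \<in> W (restrict f {..<k}) x)} \<le> card V ^ k * card X * M ^ (n - k)"
    (is "card ?Bad \<le> _")
proof -
  \<comment> \<open>Singletons in the first \<open>k\<close> positions pin down the prefix, so every
    piece is a product set.\<close>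
  define P where "P = (\<lambda>(g, x). PiE {..<n} (\<lambda>j::nat. if j < k then {g j} else W g x))"
  have finG: "finite G"
    using G V by (meson finite_PiE finite_lessThan finite_subset)
  have sub: "?Bad \<subseteq> (\<Union>p\<in>G \<times> X. P p)"
  proof
    fix f assume f: "f \<in> ?Bad"
    then have fV: "f \<in> {..<n} \<rightarrow>\<^sub>E V"
      by blast
    obtain x where x: "x \<in> X" "\<forall>j\<in>{k..<n}. f j \<in> W (restrict f {..<k}) x"
      using f by blast
    have "f \<in> P (restrict f {..<k}, x)"
      unfolding P_def prod.case
    proof (rule PiE_I)
      show "f j \<in> (if j < k then {restrict f {..<k} j} else W (restrict f {..<k}) x)"
        if "j \<in> {..<n}" for j
        using that x by simp
      show "f j = undefined" if "j \<notin> {..<n}" for j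
        using PiE_arb[OF fV that] .
    qed
    then show "f \<in> (\<Union>p\<in>G \<times> X. P p)"
      using f x by blast
  qed
  have W_fin: "finite (W g x)" if "g \<in> G" "x \<in> X" for g x
    using W[OF that] V finite_subset by blast
  have finP: "finite (P p)" if "p \<in> G \<times> X" for p
    using that W_fin by (auto simp: P_def intro!: finite_PiE)
  have cardP: "card (P p) \<le> M ^ (n - k)" if p: "p \<in> G \<times> X" for p
  proof -
    obtain g x where gx: "p = (g, x)" "g \<in> G" "x \<in> X"
      using p by blast
    have "card (P p) = (\<Prod>j<n. if j < k then 1 else card (W g x))"
      unfolding gx P_def prod.case by (subst card_PiE) (auto intro!: prod.cong)
    also have "\<dots> = card (W g x) ^ (n - k)"
      using prod_lessThan_if[OF \<open>k \<le> n\<close>, of 1 "card (W g x)"] by simp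
    also have "\<dots> \<le> M ^ (n - k)"
      using W gx by (intro power_mono) auto
    finally show ?thesis .
  qed
  have "card ?Bad \<le> card (\<Union>p\<in>G \<times> X. P p)"
    using sub finG X finP by (intro card_mono) auto
  also have "\<dots> \<le> (\<Sum>p\<in>G \<times> X. card (P p))"
    using finG X by (intro card_UN_le) auto
  also have "\<dots> \<le> (\<Sum>p\<in>G \<times> X. M ^ (n - k))"
    using cardP by (rule sum_mono)
  also have "\<dots> = card G * card X * M ^ (n - k)"
    by (simp add: card_cartesian_product)
  also have "\<dots> \<le> card V ^ k * card X * M ^ (n - k)"
  proof -
    have "card G \<le> card ({..<k} \<rightarrow>\<^sub>E V)"
      using G V by (intro card_mono finite_PiE) auto
    then show ?thesis
      by (simp add: card_PiE)
  qed
  finally show ?thesis .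
qed

section \<open>From random matrices to families of columns\<close>

definition column_fun :: "'a::zero mat \<Rightarrow> nat \<Rightarrow> nat \<Rightarrow> 'a" where
  "column_fun A = (\<lambda>j\<in>{..<dim_col A}. \<lambda>i. if i < dim_row A then A $$ (i, j) else 0)"

text \<open>Zero padding of rows and \<open>undefined\<close> beyond the last column make the
  encoding land exactly in the extensional functions, so probabilities of matrices become the counts
  above.\<close>

lemma bij_betw_column_fun:
  "bij_betw column_fun (carrier_mat m n) ({..<n} \<rightarrow>\<^sub>E (vecs m :: (nat \<Rightarrow> 'a::zero) set))"
proof (rule bij_betw_byWitness[where f' = "\<lambda>f. Matrix.mat m n (\<lambda>(i, j). f j i)"])
  show "\<forall>A\<in>carrier_mat m n. Matrix.mat m n (\<lambda>(i, j). column_fun A j i) = A"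
    by (auto simp: column_fun_def intro!: eq_matI)
  show "\<forall>f\<in>{..<n} \<rightarrow>\<^sub>E vecs m. column_fun (Matrix.mat m n (\<lambda>(i, j). f j i)) = (f :: nat \<Rightarrow> nat \<Rightarrow> 'a)"
  proof
    fix f :: "nat \<Rightarrow> nat \<Rightarrow> 'a" assume f: "f \<in> {..<n} \<rightarrow>\<^sub>E vecs m"
    show "column_fun (Matrix.mat m n (\<lambda>(i, j). f j i)) = f"
    proof
      fix j
      show "column_fun (Matrix.mat m n (\<lambda>(i, j). f j i)) j = f j"
      proof (cases "j < n")
        case True
        then have "f j \<in> vecs m"
          using PiE_mem[OF f] by simp
        then show ?thesis
          using True by (auto simp: column_fun_def vecs_def fun_eq_iff)
      next
        case False
        then show ?thesis
          using PiE_arb[OF f] by (simp add: column_fun_def)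
      qed
    qed
  qed
  show "column_fun ` carrier_mat m n \<subseteq> {..<n} \<rightarrow>\<^sub>E (vecs m :: (nat \<Rightarrow> 'a) set)"
    by (auto simp: column_fun_def vecs_def)
  show "(\<lambda>f. Matrix.mat m n (\<lambda>(i, j). f j i)) ` ({..<n} \<rightarrow>\<^sub>E (vecs m :: (nat \<Rightarrow> 'a) set)) \<subseteq> carrier_mat m n"
    by (rule image_subsetI) simp
qed

lemma indep_columns_iff_family_indep:
  fixes A :: "'a::field mat"
  assumes J: "J \<subseteq> {..<dim_col A}"
  shows "indep_columns A J \<longleftrightarrow> family_indep (column_fun A) J"
proof -
  have "(\<Sum>j\<in>J. c j * column_fun A j i) = (if i < dim_row A then (\<Sum>j\<in>J. c j * A $$ (i, j)) else 0)" for c i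
  proof -
    have "(\<Sum>j\<in>J. c j * column_fun A j i) = (\<Sum>j\<in>J. if i < dim_row A then c j * A $$ (i, j) else 0)"
      using J by (intro sum.cong) (auto simp: column_fun_def)
    then show ?thesis
      by simp
  qed
  then show ?thesis
    unfolding indep_columns_iff[OF J] family_indep_def by simp
qed

text \<open>The first term pays for the first \<open>k\<close> columns failing to span, the second
  for some vector of length \<open>d\<close> being missed by the contracted tail.\<close>

lemma prob_graphic_le:
  assumes d: "CARD('a::{field, finite}) > 2 \<and> d = 2 \<or> CARD('a) = 2 \<and> d = 3"
    and dm: "d \<le> m" and kn: "k \<le> n"
  shows "measure_pmf.prob (uniform_mat m n :: 'a mat pmf) {A. graphic (column_matroid A)}
    \<le> real CARD('a) ^ m / real CARD('a) ^ k + real CARD('a) ^ d * (1 - 1 / real CARD('a) ^ d) ^ (n - k)"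
proof -
  let ?q = "CARD('a)"
  let ?V = "vecs m :: (nat \<Rightarrow> 'a) set"
  let ?X = "vecs d :: (nat \<Rightarrow> 'a) set"
  have q0: "0 < ?q"
    by simp
  have finV: "finite ?V"
    by (rule finite_vecs)
  define G where "G = {g \<in> {..<k} \<rightarrow>\<^sub>E ?V. ?V \<subseteq> fvs.span (g ` {..<k})}"
  define Q where "Q = (\<lambda>g C (\<rho> :: (nat \<Rightarrow> 'a) \<Rightarrow> nat \<Rightarrow> 'a). C \<subseteq> {..<k} \<and>
    (\<forall>h T. (\<forall>j<k. h j = g j) \<longrightarrow> finite T \<longrightarrow> C \<inter> T = {} \<longrightarrow> h ` T \<subseteq> ?V \<longrightarrow>
      (family_indep h (C \<union> T) \<longleftrightarrow> family_indep (\<lambda>j. \<rho> (h j)) T)) \<and>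
    (\<forall>x\<in>?X. ?q ^ d * card {v \<in> ?V. \<rho> v = x} = ?q ^ m))"
  have "\<exists>C \<rho>. Q g C \<rho>" if "g \<in> G" for g
  proof -
    have g: "g ` {..<k} \<subseteq> ?V" "?V \<subseteq> fvs.span (g ` {..<k})"
      using that by (auto simp: G_def)
    obtain C and \<rho> :: "(nat \<Rightarrow> 'a) \<Rightarrow> nat \<Rightarrow> 'a" where "C \<subseteq> {..<k}"
      "\<And>h T. (\<And>j. j < k \<Longrightarrow> h j = g j) \<Longrightarrow> finite T \<Longrightarrow> C \<inter> T = {} \<Longrightarrow> h ` T \<subseteq> vecs m \<Longrightarrow>
        family_indep h (C \<union> T) \<longleftrightarrow> family_indep (\<lambda>j. \<rho> (h j)) T"
      "\<And>x. x \<in> vecs d \<Longrightarrow> CARD('a) ^ d * card {v \<in> vecs m. \<rho> v = x} = CARD('a) ^ m"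
      using spanning_contraction[OF g dm] by blast
    then have "Q g C \<rho>"
      unfolding Q_def by simp
    then show ?thesis
      by blast
  qed
  \<comment> \<open>The choice is a function of the prefix only, as the count of \<open>Bad2\<close>
    requires.\<close>
  then obtain C \<rho> where Q: "\<And>g. g \<in> G \<Longrightarrow> Q g (C g) (\<rho> g)"
    by metis
  \<comment> \<open>The number of vectors that \<open>\<rho>\<close> does not send to a given
    target, each fibre having \<open>q^(m-d)\<close> elements.\<close>
  define M where "M = ?q ^ m - ?q ^ (m - d)"
  define Bad1 where "Bad1 = {f \<in> {..<n} \<rightarrow>\<^sub>E ?V. \<not> ?V \<subseteq> fvs.span (f ` {..<k})}"
  define Bad2 where "Bad2 = {f \<in> {..<n} \<rightarrow>\<^sub>E ?V. restrict f {..<k} \<in> G \<and>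
      (\<exists>x\<in>?X. \<forall>j\<in>{k..<n}. f j \<in> {v \<in> ?V. \<rho> (restrict f {..<k}) v \<noteq> x})}"
  have cov: "column_fun A \<in> Bad1 \<union> Bad2" if A: "A \<in> carrier_mat m n" and gr: "graphic (column_matroid A)"
    for A :: "'a mat"
  proof (rule ccontr)
    assume nb: "column_fun A \<notin> Bad1 \<union> Bad2"
    have dims: "dim_row A = m" "dim_col A = n"
      using A by auto
    have cA: "column_fun A \<in> {..<n} \<rightarrow>\<^sub>E ?V"
      using bij_betw_column_fun[of m n] A by (auto simp: bij_betw_def)
    define g where "g = restrict (column_fun A) {..<k}"
    have im: "g ` {..<k} = column_fun A ` {..<k}"
      by (simp add: g_def)
    have cV: "column_fun A j \<in> ?V" if "j < n" for j
      using PiE_mem[OF cA] that by simp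
    have "g \<in> {..<k} \<rightarrow>\<^sub>E ?V"
      unfolding g_def restrict_PiE_iff using cV kn by simp
    moreover have "?V \<subseteq> fvs.span (g ` {..<k})"
      using nb cA unfolding im Bad1_def by blast
    ultimately have gG: "g \<in> G"
      by (simp add: G_def)
    note Qg = Q[OF gG, unfolded Q_def]
    have CX: "C g \<subseteq> {..<k}"
      using Qg by blast
    have contr: "indep_columns A (C g \<union> T) \<longleftrightarrow> family_indep (\<lambda>j. \<rho> g (column_fun A j)) T"
      if T: "T \<subseteq> {k..<dim_col A}" for T
    proof -
      have "indep_columns A (C g \<union> T) \<longleftrightarrow> family_indep (column_fun A) (C g \<union> T)"
        using T CX kn dims by (intro indep_columns_iff_family_indep) auto
      moreover have "\<forall>j<k. column_fun A j = g j" "finite T"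
        using T by (auto simp: g_def intro: finite_subset)
      moreover have "C g \<inter> T = {}"
        using T CX by fastforce
      moreover have "column_fun A ` T \<subseteq> ?V"
        using T dims by (intro image_subsetI cV) auto
      ultimately show ?thesis
        using Qg by blast
    qed
    have onto: "\<exists>j\<in>{k..<dim_col A}. \<rho> g (column_fun A j) = x" if "x \<in> ?X" for x
    proof (rule ccontr)
      assume "\<not> ?thesis"
      then have "\<forall>j\<in>{k..<n}. column_fun A j \<in> {v \<in> ?V. \<rho> g v \<noteq> x}"
        using cV dims by auto
      then have "column_fun A \<in> Bad2"
        using cA gG that unfolding Bad2_def g_def by blast
      then show False
        using nb by blast
    qed
    have kA: "k \<le> dim_col A"
      using kn dims by simp
    show False
      using d
    proof
      assume "CARD('a) > 2 \<and> d = 2"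
      then show False
        using not_graphic_of_plane[OF _ CX kA contr] onto gr by blast
    next
      assume "CARD('a) = 2 \<and> d = 3"
      then show False
        using not_graphic_of_space[OF _ CX kA contr] onto gr by blast
    qed
  qed
  have card1: "?q ^ k * card Bad1 \<le> ?q ^ m * (?q ^ m) ^ n"
    unfolding Bad1_def by (rule card_nonspanning[OF kn])
  have card2: "card Bad2 \<le> card ?V ^ k * card ?X * M ^ (n - k)"
    unfolding Bad2_def
  proof (rule card_confined_tail)
    show "finite ?V" "finite ?X"
      by (rule finite_vecs)+
    show "G \<subseteq> {..<k} \<rightarrow>\<^sub>E ?V"
      by (auto simp: G_def)
    fix g x assume gx: "g \<in> G" "x \<in> ?X"
    have "?q ^ d * card {v \<in> ?V. \<rho> g v = x} = ?q ^ m"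
      using Q[OF gx(1)] gx(2) by (simp add: Q_def)
    also have "\<dots> = ?q ^ d * ?q ^ (m - d)"
      using dm by (simp flip: power_add)
    finally have "card {v \<in> ?V. \<rho> g v = x} = ?q ^ (m - d)"
      by simp
    moreover have "{v \<in> ?V. \<rho> g v \<noteq> x} = ?V - {v \<in> ?V. \<rho> g v = x}"
      by blast
    ultimately show "{v \<in> ?V. \<rho> g v \<noteq> x} \<subseteq> ?V \<and> card {v \<in> ?V. \<rho> g v \<noteq> x} \<le> M"
      using finV by (simp add: card_Diff_subset card_vecs M_def)
  qed (rule kn)
  have fin: "finite (Bad1 \<union> Bad2)"
    using finV by (auto simp: Bad1_def Bad2_def intro!: finite_PiE)
  have "card (carrier_mat m n \<inter> {A :: 'a mat. graphic (column_matroid A)}) \<le> card (Bad1 \<union> Bad2)"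
    using bij_betw_column_fun[of m n, where ?'a = 'a] cov fin
    by (intro card_inj_on_le[of column_fun]) (auto simp: bij_betw_def intro: inj_on_subset)
  also have "\<dots> \<le> card Bad1 + card Bad2"
    by (rule card_Un_le)
  finally have bad: "real (card (carrier_mat m n \<inter> {A :: 'a mat. graphic (column_matroid A)})) \<le>
      real (card Bad1) + real (card Bad2)"
    by (simp flip: of_nat_add)
  have total: "card (carrier_mat m n :: 'a mat set) = (?q ^ m) ^ n"
    using bij_betw_same_card[OF bij_betw_column_fun[of m n, where ?'a = 'a]] by (simp add: card_PiE card_vecs)
  define N where "N = (real ?q ^ m) ^ n"
  have N: "N > 0"
    by (simp add: N_def)
  have b1: "real (card Bad1) \<le> real ?q ^ m / real ?q ^ k * N"
  proof -
    have "real ?q ^ k * real (card Bad1) \<le> real ?q ^ m * N"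
      using card1[THEN of_nat_mono[where ?'a = real]] by (simp add: N_def)
    then show ?thesis
      using q0 by (simp add: field_simps)
  qed
  have realM: "real M = real ?q ^ m * (1 - 1 / real ?q ^ d)"
  proof -
    have "?q ^ (m - d) \<le> ?q ^ m"
      by (intro power_increasing) (auto simp: Suc_le_eq)
    then have "real M = real ?q ^ m - real ?q ^ (m - d)"
      by (simp add: M_def)
    also have "real ?q ^ (m - d) = real ?q ^ m / real ?q ^ d"
      using dm by (intro power_diff) simp_all
    finally show ?thesis
      by (simp add: algebra_simps)
  qed
  have "real (card Bad2) \<le> (real ?q ^ m) ^ k * real ?q ^ d * real M ^ (n - k)"
    using card2[THEN of_nat_mono[where ?'a = real]] by (simp add: card_vecs)
  also have "\<dots> = (real ?q ^ m) ^ k * (real ?q ^ m) ^ (n - k) * (real ?q ^ d * (1 - 1 / real ?q ^ d) ^ (n - k))"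
    unfolding realM power_mult_distrib by (simp only: ac_simps)
  also have "(real ?q ^ m) ^ k * (real ?q ^ m) ^ (n - k) = N"
    using kn by (simp add: N_def flip: power_add)
  finally have b2: "real (card Bad2) \<le> real ?q ^ d * (1 - 1 / real ?q ^ d) ^ (n - k) * N"
    by (simp only: mult.commute)
  have "measure_pmf.prob (uniform_mat m n :: 'a mat pmf) {A. graphic (column_matroid A)} =
      real (card (carrier_mat m n \<inter> {A :: 'a mat. graphic (column_matroid A)})) / N"
    unfolding uniform_mat_def using carrier_mat_nonempty finite_carrier_mat
    by (subst measure_pmf_of_set) (auto simp: total N_def)
  also have "\<dots> \<le> real ?q ^ m / real ?q ^ k + real ?q ^ d * (1 - 1 / real ?q ^ d) ^ (n - k)"
    unfolding pos_divide_le_eq[OF N] using bad b1 b2 by (simp add: distrib_right)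
  finally show ?thesis .
qed

section \<open>Passage to the limit\<close>

theorem corollary2:
  fixes m :: "nat \<Rightarrow> nat"
  assumes "filterlim (\<lambda>n. int n - int (m n)) at_top sequentially"
    and "\<forall>\<^sub>F n in sequentially.
           (CARD('a::{field, finite}) > 2 \<longrightarrow> m n \<ge> 2) \<and> (CARD('a) = 2 \<longrightarrow> m n \<ge> 3)"
  shows "(\<lambda>n. measure_pmf.prob (uniform_mat (m n) n :: 'a mat pmf)
                {A. \<not> graphic (column_matroid A)}) \<longlonglongrightarrow> 1"
proof -
  let ?q = "real CARD('a)"
  have q2: "2 \<le> CARD('a)"
    using card_mono[of UNIV "{0, 1 :: 'a}"] by simp
  define d :: nat where "d = (if CARD('a) = 2 then 3 else 2)"
  \<comment> \<open>Half of the surplus of columns. The subtraction is done in the integers and cut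
    off at zero, since \<open>m n\<close> may exceed \<open>n\<close> for small
    \<open>n\<close>.\<close>
  define r where "r = (\<lambda>n. nat (int n - int (m n)) div 2)"
  \<comment> \<open>The bound of \<open>prob_graphic_le\<close> for \<open>k = m n + r n\<close>,
    with the exponent \<open>n - k\<close> lowered to \<open>r n\<close>; rounding in
    \<open>r\<close> can leave one column more than that.\<close>
  define \<epsilon> where "\<epsilon> = (\<lambda>s. (1 / ?q) ^ s + ?q ^ d * (1 - 1 / ?q ^ d) ^ s)"
  have "filterlim r at_top sequentially"
    unfolding filterlim_at_top
  proof
    fix Z
    have "\<forall>\<^sub>F n in sequentially. int (2 * Z) \<le> int n - int (m n)"
      using assms(1) unfolding filterlim_at_top by blast
    then show "\<forall>\<^sub>F n in sequentially. Z \<le> r n"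
      by (rule eventually_mono) (simp add: r_def)
  qed
  moreover have "\<epsilon> \<longlonglongrightarrow> 0"
  proof -
    have "1 \<le> ?q ^ d"
      using q2 by (intro one_le_power) simp
    then have "0 < 1 / ?q ^ d" "1 / ?q ^ d \<le> 1"
      using q2 by simp_all
    then have "\<bar>1 - 1 / ?q ^ d\<bar> < 1"
      by linarith
    then have "(\<lambda>s. (1 / ?q) ^ s) \<longlonglongrightarrow> 0" "(\<lambda>s. (1 - 1 / ?q ^ d) ^ s) \<longlonglongrightarrow> 0"
      using q2 by (intro LIMSEQ_power_zero; simp)+
    then have "\<epsilon> \<longlonglongrightarrow> 0 + ?q ^ d * 0"
      unfolding \<epsilon>_def by (intro tendsto_add tendsto_mult_left)
    then show ?thesis
      by simp
  qed
  ultimately have "(\<lambda>n. \<epsilon> (r n)) \<longlonglongrightarrow> 0"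
    by (rule filterlim_compose[rotated])
  then have lim: "(\<lambda>n. 1 - \<epsilon> (r n)) \<longlonglongrightarrow> 1"
    using tendsto_diff[OF tendsto_const[of "1 :: real"]] by fastforce
  have pos: "\<forall>\<^sub>F n in sequentially. 0 \<le> int n - int (m n)"
    using assms(1) unfolding filterlim_at_top by blast
  have bound: "1 - \<epsilon> (r n) \<le> measure_pmf.prob (uniform_mat (m n) n :: 'a mat pmf)
      {A. \<not> graphic (column_matroid A)}"
    if n: "(CARD('a) > 2 \<longrightarrow> m n \<ge> 2) \<and> (CARD('a) = 2 \<longrightarrow> m n \<ge> 3)" "0 \<le> int n - int (m n)" for n
  proof -
    let ?P = "measure_pmf.prob (uniform_mat (m n) n :: 'a mat pmf)"
    let ?k = "m n + r n"
    have k: "?k \<le> n" "r n \<le> n - ?k"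
      using n(2) by (simp_all add: r_def nat_diff_distrib)
    have "?P {A. graphic (column_matroid A)} \<le>
        ?q ^ m n / ?q ^ ?k + ?q ^ d * (1 - 1 / ?q ^ d) ^ (n - ?k)"
      using q2 n(1) k by (intro prob_graphic_le) (auto simp: d_def)
    also have "?q ^ m n / ?q ^ ?k = (1 / ?q) ^ r n"
      by (simp add: power_add power_one_over)
    also have "(1 - 1 / ?q ^ d) ^ (n - ?k) \<le> (1 - 1 / ?q ^ d) ^ r n"
      using k(2) q2 by (intro power_decreasing) (auto simp: one_le_power)
    finally have "?P {A. graphic (column_matroid A)} \<le> \<epsilon> (r n)"
      by (simp add: \<epsilon>_def)
    moreover have "?P {A. \<not> graphic (column_matroid A)} = 1 - ?P {A. graphic (column_matroid A)}"
      using measure_pmf.prob_compl[of "{A. graphic (column_matroid A)}" "uniform_mat (m n) n :: 'a mat pmf"]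
      by (simp add: set_diff_eq)
    ultimately show ?thesis
      by simp
  qed
  show ?thesis
  proof (rule tendsto_sandwich[OF _ _ lim tendsto_const])
    show "\<forall>\<^sub>F n in sequentially. 1 - \<epsilon> (r n) \<le> measure_pmf.prob (uniform_mat (m n) n :: 'a mat pmf)
        {A. \<not> graphic (column_matroid A)}"
      using assms(2) pos by eventually_elim (rule bound)
  qed simp
qed

end
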